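(* For an integer $a\ge 3$, let $\rho>1$, $\rho'\in(-1,0)$, $\rho''<-1$ be the roots of $x^3+(a-1)x^2-ax-1$. For an integer $a\ge 5$, let $\psi>0$, $\psi'\in(-1,-\tfrac12)$, $\psi''\in(-\tfrac12,0)$ be the roots of $x^3-(a-1)x^2-ax-1$. Then: (1) all semiconvergents of the Jacobi--Perron expansions of the vectors $(1,-\rho',\rho'^2)$, $(1,-\psi',\psi'^2)$ and $(1,-\psi'',\psi''^2)$ are $\mathfrak{s}$-indecomposable in their signatures; (2) for each of the vectors $(1,\rho,\rho^2)$, $(1,-\rho'',\rho''^2)$ and $(1,\psi,\psi^2)$, some semiconvergent of its Jacobi--Perron expansion is $\mathfrak{s}$-decomposable in its signature.
   Context: The (homogeneous) Jacobi--Perron expansion of $\boldsymbol{\beta}^{(0)}=(\beta_1^{(0)},\beta_2^{(0)},\beta_3^{(0)})\in\mathbb{R}^3$ is the sequence $\boldsymbol{\beta}^{(k)}$, $k\ge 0$, with $$\boldsymbol{\beta}^{(k+1)}=\left(\beta_2^{(k)}-b_2^{(k)}\beta_1^{(k)},\ \beta_3^{(k)}-b_3^{(k)}\beta_1^{(k)},\ \beta_1^{(k)}\right),\qquad b_i^{(k)}=\left\lfloor \beta_i^{(k)}/\beta_1^{(k)}\right\rfloor .$$ The semiconvergents of the expansion are the elements $\delta_{i,j}^{(k)}=\beta_i^{(k)}-j\beta_1^{(k)}$ with $i\in\{2,3\}$, $k\ge 0$ and $0\le j\le b_i^{(k)}-1$. For the vector $(1,|\theta|,\theta^2)$ with $\theta$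 a root of $x^3+(a-1)x^2-ax-1$ for an integer $a\ge 3$ (that is, $\theta\in\{\rho,\rho',\rho''\}$, where $\rho>1$, $\rho'\in(-1,0)$, $\rho''<-1$) or a root of $x^3-(a-1)x^2-ax-1$ for an integer $a\ge 5$ (that is, $\theta\in\{\psi,\psi',\psi''\}$, where $\psi>0$, $\psi'\in(-1,-\tfrac12)$, $\psi''\in(-\tfrac12,0)$), all semiconvergents lie in the order $\mathcal{O}=\mathbb{Z}[\theta]$ of the totally real cubic field $\mathbb{Q}(\theta)$. The signature of a nonzero $\alpha\in\mathbb{Q}(\theta)$ is the triple of signs of $\sigma_1(\alpha),\sigma_2(\alpha),\sigma_3(\alpha)$, where $\sigma_1,\sigma_2,\sigma_3$ are the embeddings of $\mathbb{Q}(\theta)$ into $\mathbb{R}$. An element $\alpha\in\mathcal{O}$ of signature $\mathfrak{s}$ is $\mathfrak{s}$-indecomposable (indecomposable in its signature) if it is not of the form $\beta+\gamma$ with $\beta,\gamma\in\mathcal{O}$ both of signature $\mathfrak{s}$, and $\mathfrak{s}$-decomposable otherwise. *)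

theory Defs
  imports "HOL-Algebra.Algebra" "HOL-Algebra.Algebraic_Closure_Type"
begin

section \<open>Homogeneous Jacobi--Perron expansion\<close>

definition jp_step :: "real \<times> real \<times> real \<Rightarrow> real \<times> real \<times> real" where
  "jp_step = (\<lambda>(x, y, z).
     (y - of_int \<lfloor>y / x\<rfloor> * x, z - of_int \<lfloor>z / x\<rfloor> * x, x))"

definition jp_seq :: "real \<times> real \<times> real \<Rightarrow> nat \<Rightarrow> real \<times> real \<times> real" where
  "jp_seq v k = (jp_step ^^ k) v"

definition jp_semiconvergents :: "real \<times> real \<times> real \<Rightarrow> real set" where
  "jp_semiconvergents v =
     {y - of_int j * x | k x y z j. jp_seq v k = (x, y, z) \<and> 0 \<le> j \<and> j \<le> \<lfloor>y / x\<rfloor> - 1} \<union>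
     {z - of_int j * x | k x y z j. jp_seq v k = (x, y, z) \<and> 0 \<le> j \<and> j \<le> \<lfloor>z / x\<rfloor> - 1}"


section \<open>Signatures and indecomposables in \<open>\<int>[\<theta>]\<close>\<close>

abbreviation real_ring :: "real ring" where
  "real_ring \<equiv> ring_of_type_algebra"

definition Z_adjoin :: "real \<Rightarrow> real set" where
  "Z_adjoin \<theta> = generate_ring real_ring {\<theta>}"

definition Q_adjoin :: "real \<Rightarrow> real set" where
  "Q_adjoin \<theta> = generate_field real_ring {\<theta>}"

text \<open>
  Embeddings of a subfield \<open>K\<close> of the reals into the reals; extensionality makes each of them
  occur only once as a total function.
\<close>
definition real_embeddings :: "real set \<Rightarrow> (real \<Rightarrow> real) set" where
  "real_embeddings K = ring_hom (real_ring\<lparr>carrier := K\<rparr>) real_ring \<inter> extensional K"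

text \<open>
  The tuple of signs is indexed by the embeddings themselves, so that no enumeration
  of the embeddings has to be chosen.
\<close>
definition signature :: "real set \<Rightarrow> real \<Rightarrow> (real \<Rightarrow> real) \<Rightarrow> real" where
  "signature K \<alpha> = (\<lambda>\<sigma>\<in>real_embeddings K. sgn (\<sigma> \<alpha>))"

definition sig_indecomposable :: "real \<Rightarrow> real \<Rightarrow> bool" where
  "sig_indecomposable \<theta> \<alpha> \<longleftrightarrow> \<alpha> \<in> Z_adjoin \<theta> - {0} \<and>
     \<not> (\<exists>\<beta>\<in>Z_adjoin \<theta> - {0}. \<exists>\<gamma>\<in>Z_adjoin \<theta> - {0}.
          signature (Q_adjoin \<theta>) \<beta> = signature (Q_adjoin \<theta>) \<alpha> \<and>
          signature (Q_adjoin \<theta>) \<gamma> = signature (Q_adjoin \<theta>) \<alpha> \<and>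
          \<alpha> = \<beta> + \<gamma>)"

definition sig_decomposable :: "real \<Rightarrow> real \<Rightarrow> bool" where
  "sig_decomposable \<theta> \<alpha> \<longleftrightarrow> \<alpha> \<in> Z_adjoin \<theta> - {0} \<and> \<not> sig_indecomposable \<theta> \<alpha>"

end

theory Submission
  imports Defs
begin

text \<open>
  Since \<open>1 + 1 / \<psi>\<close> is a root of the first cubic with parameter \<open>a - 2\<close> and generates the same
  order, everything takes place in \<open>\<int>[\<theta>]\<close> for a root \<open>\<theta>\<close> of \<open>m = x\<^sup>3 + (a - 1) x\<^sup>2 - a x - 1\<close>, where
  \<open>\<theta>\<close> and \<open>1 - \<theta>\<close> are units. Up to units the expansions in part (1) run into explicit cycles, and each of
  their semiconvergents is a unit times \<open>1\<close>, times \<open>2 - \<theta>\<close>, or times \<open>1 + p\<theta> - q\<theta>\<^sup>2\<close> with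
  \<open>(p, q)\<close> in a lattice triangle. The last elements have signs \<open>+, +, -\<close> at the roots
  \<open>\<rho>, \<rho>', \<rho>''\<close>, and the constant coefficient is the trace form with weights \<open>1 / (t m'(t))\<close>, which
  have the same signs; so it is a positive integer on that signature, and an element
  with constant coefficient 1 cannot be a sum of two others. Totally positive elements are treated in the
  same way with the forms \<open>c\<^sub>0 + c\<^sub>2\<close> and \<open>c\<^sub>0 + 2 c\<^sub>2\<close>. Part (2) is settled by explicit decompositions
  of early semiconvergents.
\<close>

section \<open>Subrings and subfields of the reals generated by one element\<close>

lemma real_ring_simps [simp]:
  "carrier real_ring = UNIV" "x \<otimes>\<^bsub>real_ring\<^esub> y = x * y" "x \<oplus>\<^bsub>real_ring\<^esub> y = x + y"
  "\<one>\<^bsub>real_ring\<^esub> = 1" "\<zero>\<^bsub>real_ring\<^esub> = 0"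
  by (auto simp: ring_of_type_algebra_def)

lemma real_ring_a_inv [simp]: "\<ominus>\<^bsub>real_ring\<^esub> x = - x"
proof -
  interpret ring real_ring by (rule ring_from_type_algebra)
  have "x \<oplus>\<^bsub>real_ring\<^esub> (\<ominus>\<^bsub>real_ring\<^esub> x) = \<zero>\<^bsub>real_ring\<^esub>"
    by (rule r_neg) simp
  then show ?thesis by simp
qed

lemma real_ring_m_inv [simp]:
  assumes "x \<noteq> 0"
  shows "inv\<^bsub>real_ring\<^esub> x = inverse x"
proof -
  interpret field real_ring by (rule field_from_type_algebra)
  have "x \<otimes>\<^bsub>real_ring\<^esub> inv\<^bsub>real_ring\<^esub> x = \<one>\<^bsub>real_ring\<^esub>"
    using assms by (intro Units_r_inv) (auto simp: field_Units)
  then have "x * inv\<^bsub>real_ring\<^esub> x = 1" by simp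
  then show ?thesis by (metis inverse_unique)
qed

lemma Z_adjoin_one [simp, intro]: "1 \<in> Z_adjoin \<theta>"
  using generate_ring.one[of real_ring "{\<theta>}"] by (simp add: Z_adjoin_def)

lemma Z_adjoin_gen [simp, intro]: "\<theta> \<in> Z_adjoin \<theta>"
  using generate_ring.incl[of \<theta> "{\<theta>}" real_ring] by (simp add: Z_adjoin_def)

lemma Z_adjoin_uminus [intro]: "x \<in> Z_adjoin \<theta> \<Longrightarrow> - x \<in> Z_adjoin \<theta>"
  using generate_ring.a_inv[of x real_ring "{\<theta>}"] by (simp add: Z_adjoin_def)

lemma Z_adjoin_add [intro]: "x \<in> Z_adjoin \<theta> \<Longrightarrow> y \<in> Z_adjoin \<theta> \<Longrightarrow> x + y \<in> Z_adjoin \<theta>"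
  using generate_ring.eng_add[of x real_ring "{\<theta>}" y] by (simp add: Z_adjoin_def)

lemma Z_adjoin_mult [intro]: "x \<in> Z_adjoin \<theta> \<Longrightarrow> y \<in> Z_adjoin \<theta> \<Longrightarrow> x * y \<in> Z_adjoin \<theta>"
  using generate_ring.eng_mult[of x real_ring "{\<theta>}" y] by (simp add: Z_adjoin_def)

lemma Z_adjoin_diff [intro]: "x \<in> Z_adjoin \<theta> \<Longrightarrow> y \<in> Z_adjoin \<theta> \<Longrightarrow> x - y \<in> Z_adjoin \<theta>"
  using Z_adjoin_add[of x \<theta> "- y"] by auto

lemma Z_adjoin_zero [simp, intro]: "0 \<in> Z_adjoin \<theta>"
  using Z_adjoin_diff[of 1 \<theta> 1] by simp

lemma Z_adjoin_power [intro]: "x \<in> Z_adjoin \<theta> \<Longrightarrow> x ^ n \<in> Z_adjoin \<theta>"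
  by (induction n) auto

lemma Z_adjoin_of_int [simp, intro]: "of_int n \<in> Z_adjoin \<theta>"
  by (induction n rule: int_induct[where k = 0]) (simp_all add: Z_adjoin_add Z_adjoin_diff)

lemma Z_adjoin_induct [consumes 1, case_names one gen uminus add mult]:
  assumes "x \<in> Z_adjoin \<theta>" "P 1" "P \<theta>" "\<And>x. P x \<Longrightarrow> P (- x)"
    "\<And>x y. P x \<Longrightarrow> P y \<Longrightarrow> P (x + y)" "\<And>x y. P x \<Longrightarrow> P y \<Longrightarrow> P (x * y)"
  shows "P x"
  using assms(1) unfolding Z_adjoin_def
  by (induction rule: generate_ring.induct) (auto intro: assms(2-))

lemma Q_adjoin_one [simp, intro]: "1 \<in> Q_adjoin \<theta>"
  using generate_field.one[of real_ring "{\<theta>}"] by (simp add: Q_adjoin_def)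

lemma Q_adjoin_gen [simp, intro]: "\<theta> \<in> Q_adjoin \<theta>"
  using generate_field.incl[of \<theta> "{\<theta>}" real_ring] by (simp add: Q_adjoin_def)

lemma Q_adjoin_uminus [intro]: "x \<in> Q_adjoin \<theta> \<Longrightarrow> - x \<in> Q_adjoin \<theta>"
  using generate_field.a_inv[of x real_ring "{\<theta>}"] by (simp add: Q_adjoin_def)

lemma Q_adjoin_add [intro]: "x \<in> Q_adjoin \<theta> \<Longrightarrow> y \<in> Q_adjoin \<theta> \<Longrightarrow> x + y \<in> Q_adjoin \<theta>"
  using generate_field.eng_add[of x real_ring "{\<theta>}" y] by (simp add: Q_adjoin_def)

lemma Q_adjoin_mult [intro]: "x \<in> Q_adjoin \<theta> \<Longrightarrow> y \<in> Q_adjoin \<theta> \<Longrightarrow> x * y \<in> Q_adjoin \<theta>"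
  using generate_field.eng_mult[of x real_ring "{\<theta>}" y] by (simp add: Q_adjoin_def)

lemma Q_adjoin_zero [simp, intro]: "0 \<in> Q_adjoin \<theta>"
  using Q_adjoin_add[of 1 \<theta> "- 1"] by auto

lemma Q_adjoin_inverse [intro]: "x \<in> Q_adjoin \<theta> \<Longrightarrow> inverse x \<in> Q_adjoin \<theta>"
  using generate_field.m_inv[of x real_ring "{\<theta>}"]
  \<comment> \<open>The generation rule covers only nonzero \<open>x\<close>; at zero the claim
    holds by \<open>inverse 0 = 0\<close>.\<close>
  by (cases "x = 0") (simp_all add: Q_adjoin_def[symmetric])

lemma Q_adjoin_induct [consumes 1, case_names one gen uminus inverse add mult]:
  assumes "x \<in> Q_adjoin \<theta>" "P 1" "P \<theta>" "\<And>x. P x \<Longrightarrow> P (- x)"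
    "\<And>x. P x \<Longrightarrow> x \<noteq> 0 \<Longrightarrow> P (inverse x)"
    "\<And>x y. P x \<Longrightarrow> P y \<Longrightarrow> P (x + y)" "\<And>x y. P x \<Longrightarrow> P y \<Longrightarrow> P (x * y)"
  shows "P x"
  using assms(1) unfolding Q_adjoin_def
  by (induction rule: generate_field.induct) (auto intro: assms(2-))

lemma Z_adjoin_subset_Q_adjoin: "Z_adjoin \<theta> \<subseteq> Q_adjoin \<theta>"
proof
  fix x assume "x \<in> Z_adjoin \<theta>"
  then show "x \<in> Q_adjoin \<theta>"
    by (induction rule: Z_adjoin_induct) auto
qed

lemma Z_adjoin_subset: "\<phi> \<in> Z_adjoin \<theta> \<Longrightarrow> Z_adjoin \<phi> \<subseteq> Z_adjoin \<theta>"
proof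
  fix x assume \<phi>: "\<phi> \<in> Z_adjoin \<theta>" and "x \<in> Z_adjoin \<phi>"
  from this(2) show "x \<in> Z_adjoin \<theta>"
    by (induction rule: Z_adjoin_induct) (use \<phi> in auto)
qed

lemma Q_adjoin_subset: "\<phi> \<in> Q_adjoin \<theta> \<Longrightarrow> Q_adjoin \<phi> \<subseteq> Q_adjoin \<theta>"
proof
  fix x assume \<phi>: "\<phi> \<in> Q_adjoin \<theta>" and "x \<in> Q_adjoin \<phi>"
  from this(2) show "x \<in> Q_adjoin \<theta>"
    by (induction rule: Q_adjoin_induct) (use \<phi> in auto)
qed

lemma Z_adjoin_eqI: "\<phi> \<in> Z_adjoin \<theta> \<Longrightarrow> \<theta> \<in> Z_adjoin \<phi> \<Longrightarrow> Z_adjoin \<phi> = Z_adjoin \<theta>"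
  using Z_adjoin_subset by blast

lemma Q_adjoin_eqI: "\<phi> \<in> Z_adjoin \<theta> \<Longrightarrow> \<theta> \<in> Z_adjoin \<phi> \<Longrightarrow> Q_adjoin \<phi> = Q_adjoin \<theta>"
  using Q_adjoin_subset Z_adjoin_subset_Q_adjoin by blast

text \<open>Indecomposability sees its generator only through the order and the field generated.
  This later carries results from \<open>1 + 1 / \<psi>\<close> to \<open>\<psi>\<close>.\<close>

lemma sig_indecomposable_change_generator:
  assumes "\<phi> \<in> Z_adjoin \<theta>" "\<theta> \<in> Z_adjoin \<phi>"
  shows "sig_indecomposable \<phi> = sig_indecomposable \<theta>"
  by (simp add: fun_eq_iff sig_indecomposable_def Z_adjoin_eqI[OF assms] Q_adjoin_eqI[OF assms])

section \<open>Real embeddings and signatures\<close>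

lemma real_embeddings_iff:
  "\<sigma> \<in> real_embeddings K \<longleftrightarrow> \<sigma> \<in> extensional K \<and> \<sigma> 1 = 1 \<and>
     (\<forall>x\<in>K. \<forall>y\<in>K. \<sigma> (x + y) = \<sigma> x + \<sigma> y \<and> \<sigma> (x * y) = \<sigma> x * \<sigma> y)"
  by (auto simp: real_embeddings_def ring_hom_def ring_of_type_algebra_def)

context
  fixes \<theta> \<sigma>
  assumes emb: "\<sigma> \<in> real_embeddings (Q_adjoin \<theta>)"
begin

lemma embedding_one: "\<sigma> 1 = 1"
  and embedding_add: "x \<in> Q_adjoin \<theta> \<Longrightarrow> y \<in> Q_adjoin \<theta> \<Longrightarrow> \<sigma> (x + y) = \<sigma> x + \<sigma> y"
  and embedding_mult: "x \<in> Q_adjoin \<theta> \<Longrightarrow> y \<in> Q_adjoin \<theta> \<Longrightarrow> \<sigma> (x * y) = \<sigma> x * \<sigma> y"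
  using emb by (auto simp: real_embeddings_iff)

lemma embedding_zero: "\<sigma> 0 = 0"
  using embedding_add[of 0 0] by auto

lemma embedding_uminus: "x \<in> Q_adjoin \<theta> \<Longrightarrow> \<sigma> (- x) = - \<sigma> x"
  using embedding_add[of x "- x"] Q_adjoin_uminus[of x] embedding_zero by force

lemma embedding_of_int: "\<sigma> (of_int n) = of_int n"
proof -
  have mem: "of_int m \<in> Q_adjoin \<theta>" for m
    using Z_adjoin_subset_Q_adjoin by blast
  have "\<sigma> (of_int n - 1) = \<sigma> (of_int n) - 1" for n
    using embedding_add[OF mem[of n] mem[of "- 1"]] embedding_uminus[of 1] embedding_one by simp
  moreover have "\<sigma> (of_int n + 1) = \<sigma> (of_int n) + 1" for n
    using embedding_add[OF mem[of n] mem[of 1]] embedding_one by simp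
  ultimately show ?thesis
    by (induction n rule: int_induct[where k = 0]) (simp_all add: embedding_zero)
qed

text \<open>This turns signatures into signs of one integer polynomial at the conjugates of
  \<open>\<theta>\<close>.\<close>

lemma embedding_quadratic:
  "\<sigma> (of_int p + of_int q * \<theta> + of_int r * \<theta>\<^sup>2) = of_int p + of_int q * \<sigma> \<theta> + of_int r * (\<sigma> \<theta>)\<^sup>2"
proof -
  have mem: "of_int m \<in> Q_adjoin \<theta>" for m
    using Z_adjoin_subset_Q_adjoin by blast
  show ?thesis
    by (simp add: power2_eq_square embedding_add embedding_mult embedding_of_int mem Q_adjoin_add Q_adjoin_mult)
qed

end

lemma signature_eq_iff:
  "signature K \<alpha> = signature K \<beta> \<longleftrightarrow> (\<forall>\<sigma>\<in>real_embeddings K. sgn (\<sigma> \<alpha>) = sgn (\<sigma> \<beta>))"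
  unfolding signature_def by (auto simp: fun_eq_iff restrict_def)

section \<open>Units of the order and their action on signatures\<close>

text \<open>The condition \<open>u \<noteq> 0\<close> matters: \<open>inverse 0 = 0\<close> would
  otherwise make zero a unit.\<close>

definition is_unit :: "real \<Rightarrow> real \<Rightarrow> bool" where
  "is_unit \<theta> u \<longleftrightarrow> u \<in> Z_adjoin \<theta> \<and> inverse u \<in> Z_adjoin \<theta> \<and> u \<noteq> 0"

lemma is_unitI: "u \<in> Z_adjoin \<theta> \<Longrightarrow> v \<in> Z_adjoin \<theta> \<Longrightarrow> u * v = 1 \<Longrightarrow> is_unit \<theta> u"
  unfolding is_unit_def by (metis inverse_unique mult_zero_left zero_neq_one)

lemma is_unit_1 [simp, intro]: "is_unit \<theta> 1"
  by (rule is_unitI[of _ _ 1]) auto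

lemma is_unit_mult [intro]: "is_unit \<theta> u \<Longrightarrow> is_unit \<theta> v \<Longrightarrow> is_unit \<theta> (u * v)"
  by (auto simp: is_unit_def)

lemma is_unit_uminus [intro]: "is_unit \<theta> u \<Longrightarrow> is_unit \<theta> (- u)"
  by (auto simp: is_unit_def)

lemma is_unit_inverse [intro]: "is_unit \<theta> u \<Longrightarrow> is_unit \<theta> (inverse u)"
  by (auto simp: is_unit_def)

lemma is_unit_power [intro]: "is_unit \<theta> u \<Longrightarrow> is_unit \<theta> (u ^ n)"
  by (induction n) auto

text \<open>Multiplying by \<open>inverse u\<close> changes the signatures of the sum and of both
  summands by the same signs, so a decomposition of \<open>u * \<alpha>\<close> becomes one of
  \<open>\<alpha>\<close>.\<close>

lemma sig_indecomposable_unit_mult: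
  assumes u: "is_unit \<theta> u" and \<alpha>: "sig_indecomposable \<theta> \<alpha>"
  shows "sig_indecomposable \<theta> (u * \<alpha>)"
proof -
  let ?K = "Q_adjoin \<theta>"
  have Z: "x \<in> ?K" if "x \<in> Z_adjoin \<theta>" for x
    using that Z_adjoin_subset_Q_adjoin by blast
  have *: "signature ?K (inverse u * \<beta>) = signature ?K \<alpha>"
    if \<beta>: "\<beta> \<in> Z_adjoin \<theta>" "signature ?K \<beta> = signature ?K (u * \<alpha>)" for \<beta>
    unfolding signature_eq_iff
  proof
    fix \<sigma> assume \<sigma>: "\<sigma> \<in> real_embeddings ?K"
    have inv: "\<sigma> u * \<sigma> (inverse u) = 1"
      using u embedding_mult[OF \<sigma>, of u "inverse u"] embedding_one[OF \<sigma>]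
      by (auto simp: is_unit_def Z)
    have "sgn (\<sigma> \<beta>) = sgn (\<sigma> (u * \<alpha>))"
      using \<beta> \<sigma> by (auto simp: signature_eq_iff)
    also have "\<dots> = sgn (\<sigma> u) * sgn (\<sigma> \<alpha>)"
      using \<alpha> u by (simp add: embedding_mult[OF \<sigma>] Z is_unit_def sig_indecomposable_def sgn_mult)
    finally have "sgn (\<sigma> (inverse u * \<beta>)) = sgn (\<sigma> (inverse u)) * (sgn (\<sigma> u) * sgn (\<sigma> \<alpha>))"
      using \<beta> u by (simp add: embedding_mult[OF \<sigma>] Z is_unit_def sgn_mult)
    also have "\<dots> = sgn (\<sigma> u * \<sigma> (inverse u)) * sgn (\<sigma> \<alpha>)"
      by (simp add: sgn_mult)
    finally show "sgn (\<sigma> (inverse u * \<beta>)) = sgn (\<sigma> \<alpha>)"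
      by (simp add: inv)
  qed
  show ?thesis
    unfolding sig_indecomposable_def
  proof (intro conjI notI)
    show "u * \<alpha> \<in> Z_adjoin \<theta> - {0}"
      using u \<alpha> by (auto simp: is_unit_def sig_indecomposable_def)
  next
    assume "\<exists>\<beta>\<in>Z_adjoin \<theta> - {0}. \<exists>\<gamma>\<in>Z_adjoin \<theta> - {0}.
       signature ?K \<beta> = signature ?K (u * \<alpha>) \<and> signature ?K \<gamma> = signature ?K (u * \<alpha>) \<and> u * \<alpha> = \<beta> + \<gamma>"
    then obtain \<beta> \<gamma> where bg: "\<beta> \<in> Z_adjoin \<theta> - {0}" "\<gamma> \<in> Z_adjoin \<theta> - {0}"
      "signature ?K \<beta> = signature ?K (u * \<alpha>)" "signature ?K \<gamma> = signature ?K (u * \<alpha>)" "u * \<alpha> = \<beta> + \<gamma>"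
      by blast
    have "\<alpha> = inverse u * (u * \<alpha>)" using u by (simp add: is_unit_def)
    then have "\<alpha> = inverse u * \<beta> + inverse u * \<gamma>"
      by (simp only: bg distrib_left)
    moreover have "inverse u * \<beta> \<in> Z_adjoin \<theta> - {0}" "inverse u * \<gamma> \<in> Z_adjoin \<theta> - {0}"
      using u bg by (auto simp: is_unit_def)
    ultimately show False
      using \<alpha> *[of \<beta>] *[of \<gamma>] bg unfolding sig_indecomposable_def by blast
  qed
qed

section \<open>The Jacobi--Perron algorithm up to scaling\<close>

definition scale3 :: "real \<Rightarrow> real \<times> real \<times> real \<Rightarrow> real \<times> real \<times> real" where
  "scale3 u = (\<lambda>(x, y, z). (u * x, u * y, u * z))"

definition vector_semiconvergents :: "real \<times> real \<times> real \<Rightarrow> real set" where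
  "vector_semiconvergents = (\<lambda>(x, y, z).
     {y - of_int j * x | j. 0 \<le> j \<and> j \<le> \<lfloor>y / x\<rfloor> - 1} \<union>
     {z - of_int j * x | j. 0 \<le> j \<and> j \<le> \<lfloor>z / x\<rfloor> - 1})"

lemma scale3_scale3: "scale3 u (scale3 v w) = scale3 (u * v) w"
  by (simp add: scale3_def split: prod.splits)

lemma scale3_1 [simp]: "scale3 1 w = w"
  by (simp add: scale3_def split: prod.splits)

text \<open>The floors depend only on ratios of entries, so a common nonzero factor passes through
  the step.\<close>

lemma jp_step_scale3: "u \<noteq> 0 \<Longrightarrow> jp_step (scale3 u w) = scale3 u (jp_step w)"
  by (cases w) (simp add: scale3_def jp_step_def right_diff_distrib mult.left_commute)

lemma vector_semiconvergents_scale3: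
  assumes "u \<noteq> 0"
  shows "vector_semiconvergents (scale3 u w) = (*) u ` vector_semiconvergents w"
proof -
  obtain x y z where w: "w = (x, y, z)" by (cases w)
  have *: "{u * s - of_int j * (u * x) | j. 0 \<le> j \<and> j \<le> \<lfloor>u * s / (u * x)\<rfloor> - 1} =
    (*) u ` {s - of_int j * x | j. 0 \<le> j \<and> j \<le> \<lfloor>s / x\<rfloor> - 1}" (is "?L = ?R") for s
  proof -
    have eq: "u * s - of_int j * (u * x) = u * (s - of_int j * x)" for j
      by (simp add: algebra_simps)
    have "u * s / (u * x) = s / x" using assms by simp
    then show ?thesis unfolding eq by auto
  qed
  show ?thesis
    by (simp only: w scale3_def vector_semiconvergents_def prod.case * image_Un)
qed

lemma jp_semiconvergents_altdef: "jp_semiconvergents v = (\<Union>k. vector_semiconvergents (jp_seq v k))"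
proof -
  have "\<alpha> \<in> vector_semiconvergents w \<longleftrightarrow> (\<exists>x y z j. w = (x, y, z) \<and> 0 \<le> j \<and>
      (\<alpha> = y - of_int j * x \<and> j \<le> \<lfloor>y / x\<rfloor> - 1 \<or> \<alpha> = z - of_int j * x \<and> j \<le> \<lfloor>z / x\<rfloor> - 1))" for \<alpha> w
    by (cases w) (auto simp: vector_semiconvergents_def)
  note mem = this
  show ?thesis
    unfolding jp_semiconvergents_def
    by (rule Set.set_eqI) (simp only: mem UN_iff Un_iff mem_Collect_eq, blast)
qed

text \<open>By induction every term of the expansion is a unit times a member of \<open>W\<close>,
  and the same unit multiplies its semiconvergents. A finite \<open>W\<close> can thus settle an
  infinite expansion.\<close>

lemma sig_indecomposable_semiconvergents:
  assumes "v \<in> W"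
    and step: "\<And>w. w \<in> W \<Longrightarrow> \<exists>w'\<in>W. \<exists>u. is_unit \<theta> u \<and> jp_step w = scale3 u w'"
    and indec: "\<And>w \<alpha>. w \<in> W \<Longrightarrow> \<alpha> \<in> vector_semiconvergents w \<Longrightarrow> sig_indecomposable \<theta> \<alpha>"
    and "\<alpha> \<in> jp_semiconvergents v"
  shows "sig_indecomposable \<theta> \<alpha>"
proof -
  have reach: "\<exists>w\<in>W. \<exists>u. is_unit \<theta> u \<and> jp_seq v k = scale3 u w" for k
  proof (induction k)
    case 0
    show ?case using assms(1) by (intro bexI[of _ v] exI[of _ 1]) (auto simp: jp_seq_def)
  next
    case (Suc k)
    then obtain w u where w: "w \<in> W" "is_unit \<theta> u" "jp_seq v k = scale3 u w" by blast
    obtain w' u' where w': "w' \<in> W" "is_unit \<theta> u'" "jp_step w = scale3 u' w'"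
      using step[OF w(1)] by blast
    have "jp_seq v (Suc k) = jp_step (jp_seq v k)" by (simp add: jp_seq_def)
    also have "\<dots> = scale3 (u * u') w'"
      using w w' by (simp add: jp_step_scale3 scale3_scale3 is_unit_def)
    finally show ?case using w w' by blast
  qed
  from assms(4) obtain k where k: "\<alpha> \<in> vector_semiconvergents (jp_seq v k)"
    by (auto simp: jp_semiconvergents_altdef)
  from reach[of k] obtain w u where w: "w \<in> W" "is_unit \<theta> u" "jp_seq v k = scale3 u w" by blast
  then have "u \<noteq> 0" by (simp add: is_unit_def)
  then obtain \<beta> where "\<beta> \<in> vector_semiconvergents w" "\<alpha> = u * \<beta>"
    using k w(3) by (auto simp: vector_semiconvergents_scale3)
  then show ?thesis
    using indec sig_indecomposable_unit_mult w by blast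
qed

section \<open>The cubic order\<close>

definition is_root :: "int \<Rightarrow> real \<Rightarrow> bool" where
  "is_root a t \<longleftrightarrow> t ^ 3 + (of_int a - 1) * t\<^sup>2 - of_int a * t - 1 = 0"

text \<open>Rational root test: a rational root would be an integer dividing 1, but the cubic has
  the values \<open>- 1\<close> at 1 and \<open>2 * a - 3\<close> at \<open>- 1\<close>.\<close>

lemma is_root_irrational:
  assumes "a \<ge> 3" "is_root a t"
  shows "t \<notin> \<rat>"
proof
  assume "t \<in> \<rat>"
  have "poly [:- 1, - of_int a, of_int a - 1, 1:] t = 0"
    using assms(2) by (simp add: is_root_def power2_eq_square power3_eq_cube algebra_simps)
  moreover have "coeff [:- 1, - of_int a, of_int a - 1, 1 :: real:] i \<in> \<int>" for i
    by (auto simp: coeff_pCons split: nat.splits)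
  ultimately have "algebraic_int t"
    by (intro algebraic_int.intros) auto
  with \<open>t \<in> \<rat>\<close> have "t \<in> \<int>" by (intro rational_algebraic_int_is_int)
  then obtain n where n: "t = of_int n" by (elim Ints_cases)
  have "real_of_int (n ^ 3 + (a - 1) * n\<^sup>2 - a * n - 1) = 0"
    using assms(2) unfolding is_root_def n by simp
  then have eq: "n ^ 3 + (a - 1) * n\<^sup>2 - a * n - 1 = 0"
    by (simp only: of_int_eq_0_iff)
  then have "n * (n\<^sup>2 + (a - 1) * n - a) = 1"
    by (simp add: power2_eq_square power3_eq_cube algebra_simps)
  then have "n dvd 1" by (metis dvd_triv_left)
  then have "n = 1 \<or> n = -1" by auto
  with eq assms(1) show False by auto
qed

text \<open>If \<open>r \<noteq> 0\<close>, dividing the cubic by the quadratic leaves a linear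
  remainder that vanishes at the irrational \<open>t\<close>, hence identically; the linear quotient
  then yields a rational root.\<close>

lemma is_root_lin_indep:
  fixes p q r :: int
  assumes a: "a \<ge> 3" and t: "is_root a t" and zero: "of_int p + of_int q * t + of_int r * t\<^sup>2 = 0"
  shows "p = 0 \<and> q = 0 \<and> r = 0"
proof -
  have linear: "c = 0 \<and> d = 0" if "of_int c + of_int d * t = 0" for c d :: int
  proof -
    have "d = 0"
    proof (rule ccontr)
      assume "d \<noteq> 0"
      then have "t = - of_int c / of_int d" using that by (simp add: field_simps)
      then have "t \<in> \<rat>" by simp
      then show False using is_root_irrational[OF a t] by simp
    qed
    then show ?thesis using that by simp
  qed
  have "r = 0"
  proof (rule ccontr)
    assume r: "r \<noteq> 0"
    define d where "d = r * (a - 1) - q"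
    define e where "e = - (r\<^sup>2 * a) - q * d - p * r"
    define f where "f = - (r\<^sup>2) - p * d"
    \<comment> \<open>The factor \<open>r\<^sup>2\<close> keeps the quotient and the remainder
      integral.\<close>
    have division: "of_int (r\<^sup>2) * (x ^ 3 + (of_int a - 1) * x\<^sup>2 - of_int a * x - 1) =
      (of_int p + of_int q * x + of_int r * x\<^sup>2) * (of_int r * x + of_int d) + of_int e * x + of_int f"
      for x :: real
      by (simp add: d_def e_def f_def algebra_simps power2_eq_square power3_eq_cube)
    from division[of t] have "of_int f + of_int e * t = 0"
      using zero t by (simp add: is_root_def)
    then have "e = 0" "f = 0" using linear by auto
    with division[of "- of_int d / of_int r"] r have "is_root a (- of_int d / of_int r)"
      by (simp add: is_root_def)
    then show False using is_root_irrational[OF a] by fastforce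
  qed
  then show ?thesis using linear[of p q] zero by simp
qed

text \<open>Here \<open>s\<close> is the coefficient of \<open>t ^ 3\<close> once
  \<open>t ^ 4\<close> has been eliminated; eliminating \<open>t ^ 3\<close> as well gives the
  stated coefficients.\<close>

lemma is_root_quadratic_mult:
  fixes p q r p' q' r' :: int
  assumes "is_root a t"
  defines "s \<equiv> q * r' + r * q' - (a - 1) * (r * r')"
  shows "(of_int p + of_int q * t + of_int r * t\<^sup>2) * (of_int p' + of_int q' * t + of_int r' * t\<^sup>2) =
    of_int (p * p' + s) + of_int (p * q' + q * p' + r * r' + a * s) * t +
    of_int (p * r' + q * q' + r * p' + a * (r * r') - (a - 1) * s) * t\<^sup>2"
proof -
  have cube: "t ^ 3 = 1 + of_int a * t - (of_int a - 1) * t\<^sup>2"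
    using assms(1) by (simp add: is_root_def)
  have four: "t ^ 4 = t + of_int a * t\<^sup>2 - (of_int a - 1) * t ^ 3"
    using arg_cong[OF cube, of "\<lambda>x. x * t"] by (simp add: power_numeral_reduce algebra_simps)
  have "(of_int p + of_int q * t + of_int r * t\<^sup>2) * (of_int p' + of_int q' * t + of_int r' * t\<^sup>2) =
    of_int (p * p') + of_int (p * q' + q * p') * t + of_int (p * r' + q * q' + r * p') * t\<^sup>2
    + of_int (q * r' + r * q') * t ^ 3 + of_int (r * r') * t ^ 4"
    by (simp add: algebra_simps power_numeral_reduce)
  then show ?thesis
    unfolding four cube by (simp add: s_def algebra_simps)
qed

lemma is_root_Z_adjoinE:
  assumes "is_root a \<theta>" "x \<in> Z_adjoin \<theta>"
  obtains p q r :: int where "x = of_int p + of_int q * \<theta> + of_int r * \<theta>\<^sup>2"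
proof -
  from assms(2) have "\<exists>p q r :: int. x = of_int p + of_int q * \<theta> + of_int r * \<theta>\<^sup>2"
  proof (induction rule: Z_adjoin_induct)
    case one
    show ?case by (rule exI[of _ 1], rule exI[of _ 0], rule exI[of _ 0]) simp
  next
    case gen
    show ?case by (rule exI[of _ 0], rule exI[of _ 1], rule exI[of _ 0]) simp
  next
    case (uminus x)
    then obtain p q r :: int where "x = of_int p + of_int q * \<theta> + of_int r * \<theta>\<^sup>2" by blast
    then show ?case
      by (intro exI[of _ "- p"] exI[of _ "- q"] exI[of _ "- r"]) simp
  next
    case (add x y)
    then obtain p q r p' q' r' :: int where "x = of_int p + of_int q * \<theta> + of_int r * \<theta>\<^sup>2"
      "y = of_int p' + of_int q' * \<theta> + of_int r' * \<theta>\<^sup>2" by blast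
    then show ?case
      by (intro exI[of _ "p + p'"] exI[of _ "q + q'"] exI[of _ "r + r'"]) (simp add: algebra_simps)
  next
    case (mult x y)
    then obtain p q r p' q' r' :: int where xy: "x = of_int p + of_int q * \<theta> + of_int r * \<theta>\<^sup>2"
      "y = of_int p' + of_int q' * \<theta> + of_int r' * \<theta>\<^sup>2" by blast
    show ?case unfolding xy is_root_quadratic_mult[OF assms(1)] by blast
  qed
  then show ?thesis using that by blast
qed

lemma embedding_is_root:
  assumes "is_root a \<theta>" "\<sigma> \<in> real_embeddings (Q_adjoin \<theta>)"
  shows "is_root a (\<sigma> \<theta>)"
proof -
  have mem: "of_int m \<in> Q_adjoin \<theta>" for m
    using Z_adjoin_subset_Q_adjoin by blast
  have "\<theta> * \<theta>\<^sup>2 = of_int 1 + of_int a * \<theta> + of_int (1 - a) * \<theta>\<^sup>2"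
    using assms(1) by (simp add: is_root_def power2_eq_square power3_eq_cube algebra_simps)
  then have "\<sigma> (\<theta> * \<theta>\<^sup>2) = \<sigma> (of_int 1 + of_int a * \<theta> + of_int (1 - a) * \<theta>\<^sup>2)"
    by simp
  then have "\<sigma> \<theta> * (\<sigma> \<theta>)\<^sup>2 = of_int 1 + of_int a * \<sigma> \<theta> + of_int (1 - a) * (\<sigma> \<theta>)\<^sup>2"
    unfolding embedding_quadratic[OF assms(2)]
    by (simp add: power2_eq_square embedding_mult[OF assms(2)] Q_adjoin_mult)
  then show ?thesis
    by (simp add: is_root_def power2_eq_square power3_eq_cube algebra_simps)
qed

text \<open>
  The embedding is read off its graph: the pairs of values at \<open>\<theta>\<close> and \<open>t\<close> of quotients of
  integer quadratic polynomials. By linear independence this relation is single-valued.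
\<close>
lemma embedding_exists:
  assumes a: "a \<ge> 3" and \<theta>: "is_root a \<theta>" and t: "is_root a t"
  obtains \<sigma> where "\<sigma> \<in> real_embeddings (Q_adjoin \<theta>)" "\<sigma> \<theta> = t"
proof -
  define G where "G = {(of_int p + of_int q * \<theta> + of_int r * \<theta>\<^sup>2,
    of_int p + of_int q * t + of_int r * t\<^sup>2) | p q r :: int. True}"
  define F where "F = {(x / x', y / y') | x x' y y'. (x, y) \<in> G \<and> (x', y') \<in> G \<and> x' \<noteq> 0}"
  \<comment> \<open>Linear independence at both roots: either coordinate vanishes exactly when all
    three coefficients do.\<close>
  have G_zero: "x = 0 \<longleftrightarrow> y = 0" if xy: "(x, y) \<in> G" for x y
  proof -
    from xy obtain p q r :: int where
      "x = of_int p + of_int q * \<theta> + of_int r * \<theta>\<^sup>2" "y = of_int p + of_int q * t + of_int r * t\<^sup>2"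
      unfolding G_def by blast
    then show ?thesis
      using is_root_lin_indep[OF a \<theta>, of p q r] is_root_lin_indep[OF a t, of p q r] by auto
  qed
  have G_of_int: "(of_int n, of_int n) \<in> G" for n
    unfolding G_def by (simp, rule exI[of _ n], rule exI[of _ 0], rule exI[of _ 0]) simp
  have G_gen: "(\<theta>, t) \<in> G"
    unfolding G_def by (simp, rule exI[of _ 0], rule exI[of _ 1], rule exI[of _ 0]) simp
  have G_add: "(x + x', y + y') \<in> G" if xy: "(x, y) \<in> G" "(x', y') \<in> G" for x y x' y'
  proof -
    from xy obtain p q r p' q' r' :: int where
      "x = of_int p + of_int q * \<theta> + of_int r * \<theta>\<^sup>2" "y = of_int p + of_int q * t + of_int r * t\<^sup>2"
      "x' = of_int p' + of_int q' * \<theta> + of_int r' * \<theta>\<^sup>2" "y' = of_int p' + of_int q' * t + of_int r' * t\<^sup>2"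
      unfolding G_def by blast
    then show ?thesis unfolding G_def
      by (simp, intro exI[of _ "p + p'"] exI[of _ "q + q'"] exI[of _ "r + r'"]) (simp add: algebra_simps)
  qed
  have G_uminus: "(- x, - y) \<in> G" if xy: "(x, y) \<in> G" for x y
  proof -
    from xy obtain p q r :: int where
      "x = of_int p + of_int q * \<theta> + of_int r * \<theta>\<^sup>2" "y = of_int p + of_int q * t + of_int r * t\<^sup>2"
      unfolding G_def by blast
    then show ?thesis unfolding G_def
      by (simp, intro exI[of _ "- p"] exI[of _ "- q"] exI[of _ "- r"]) simp
  qed
  have G_mult: "(x * x', y * y') \<in> G" if xy: "(x, y) \<in> G" "(x', y') \<in> G" for x y x' y'
  proof -
    from xy obtain p q r p' q' r' :: int where *:
      "x = of_int p + of_int q * \<theta> + of_int r * \<theta>\<^sup>2" "y = of_int p + of_int q * t + of_int r * t\<^sup>2"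
      "x' = of_int p' + of_int q' * \<theta> + of_int r' * \<theta>\<^sup>2" "y' = of_int p' + of_int q' * t + of_int r' * t\<^sup>2"
      unfolding G_def by blast
    show ?thesis
      unfolding * G_def is_root_quadratic_mult[OF \<theta>] is_root_quadratic_mult[OF t] by blast
  qed
  have F_I: "(x / x', y / y') \<in> F" if "(x, y) \<in> G" "(x', y') \<in> G" "x' \<noteq> 0" for x y x' y'
    using that unfolding F_def by blast
  have F_G: "(x, y) \<in> F" if "(x, y) \<in> G" for x y
    using F_I[OF that G_of_int[of 1]] by simp
  have F_unique: "z = w" if zw: "(x, z) \<in> F" "(x, w) \<in> F" for x z w
  proof -
    from zw obtain x1 x1' z1 z1' x2 x2' w2 w2' where *:
      "x = x1 / x1'" "z = z1 / z1'" "(x1, z1) \<in> G" "(x1', z1') \<in> G" "x1' \<noteq> 0"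
      "x = x2 / x2'" "w = w2 / w2'" "(x2, w2) \<in> G" "(x2', w2') \<in> G" "x2' \<noteq> 0"
      unfolding F_def by blast
    \<comment> \<open>The cross-multiplied difference of the two fractions is zero in the first
      coordinate, hence in the second.\<close>
    have "(x1 * x2' + - (x2 * x1'), z1 * w2' + - (w2 * z1')) \<in> G"
      using * by (intro G_add G_uminus G_mult)
    moreover have "x1 * x2' + - (x2 * x1') = 0"
      using * by (auto simp: field_simps)
    ultimately have "z1 * w2' + - (w2 * z1') = 0" using G_zero by blast
    moreover have "z1' \<noteq> 0" "w2' \<noteq> 0" using * G_zero by auto
    ultimately show ?thesis using * by (simp add: frac_eq_eq)
  qed
  have F_add: "(x + x', y + y') \<in> F" if xy: "(x, y) \<in> F" "(x', y') \<in> F" for x y x' y'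
  proof -
    from xy obtain x1 x1' y1 y1' x2 x2' y2 y2' where *:
      "x = x1 / x1'" "y = y1 / y1'" "(x1, y1) \<in> G" "(x1', y1') \<in> G" "x1' \<noteq> 0"
      "x' = x2 / x2'" "y' = y2 / y2'" "(x2, y2) \<in> G" "(x2', y2') \<in> G" "x2' \<noteq> 0"
      unfolding F_def by blast
    have "((x1 * x2' + x2 * x1') / (x1' * x2'), (y1 * y2' + y2 * y1') / (y1' * y2')) \<in> F"
      using * by (intro F_I G_add G_mult) auto
    moreover have "y1' \<noteq> 0" "y2' \<noteq> 0" using * G_zero by auto
    ultimately show ?thesis using * by (simp add: add_frac_eq)
  qed
  have F_mult: "(x * x', y * y') \<in> F" if xy: "(x, y) \<in> F" "(x', y') \<in> F" for x y x' y'
  proof -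
    from xy obtain x1 x1' y1 y1' x2 x2' y2 y2' where *:
      "x = x1 / x1'" "y = y1 / y1'" "(x1, y1) \<in> G" "(x1', y1') \<in> G" "x1' \<noteq> 0"
      "x' = x2 / x2'" "y' = y2 / y2'" "(x2, y2) \<in> G" "(x2', y2') \<in> G" "x2' \<noteq> 0"
      unfolding F_def by blast
    have "((x1 * x2) / (x1' * x2'), (y1 * y2) / (y1' * y2')) \<in> F"
      using * by (intro F_I G_mult) auto
    then show ?thesis using * by simp
  qed
  have F_inverse: "(inverse x, inverse y) \<in> F" if xy: "(x, y) \<in> F" "x \<noteq> 0" for x y
  proof -
    from xy obtain x1 x1' y1 y1' where *:
      "x = x1 / x1'" "y = y1 / y1'" "(x1, y1) \<in> G" "(x1', y1') \<in> G" "x1' \<noteq> 0"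
      unfolding F_def by blast
    have "(x1' / x1, y1' / y1) \<in> F"
      using * xy by (intro F_I) auto
    then show ?thesis using * by simp
  qed
  have F_uminus: "(- x, - y) \<in> F" if "(x, y) \<in> F" for x y
    using F_mult[OF F_G[OF G_of_int[of "- 1"]] that] by simp
  have F_total: "\<exists>y. (x, y) \<in> F" if "x \<in> Q_adjoin \<theta>" for x
    using that
  proof (induction rule: Q_adjoin_induct)
    case one
    show ?case using F_G[OF G_of_int[of 1]] by auto
  qed (use F_G G_gen F_uminus F_inverse F_add F_mult in blast)+
  \<comment> \<open>Restricting to the field gives the extensionality that
    \<open>real_embeddings\<close> demands.\<close>
  define \<sigma> where "\<sigma> = restrict (\<lambda>x. THE y. (x, y) \<in> F) (Q_adjoin \<theta>)"
  have \<sigma>_eq: "\<sigma> x = y" if "(x, y) \<in> F" "x \<in> Q_adjoin \<theta>" for x y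
    using that F_unique by (auto simp: \<sigma>_def)
  have \<sigma>_F: "(x, \<sigma> x) \<in> F" if "x \<in> Q_adjoin \<theta>" for x
    using F_total[OF that] \<sigma>_eq[OF _ that] by blast
  show ?thesis
  proof
    show "\<sigma> \<theta> = t" by (intro \<sigma>_eq F_G G_gen) auto
    have "\<sigma> 1 = 1" using F_G[OF G_of_int[of 1]] by (intro \<sigma>_eq) auto
    then show "\<sigma> \<in> real_embeddings (Q_adjoin \<theta>)"
      unfolding real_embeddings_iff
      by (auto intro!: \<sigma>_eq F_add F_mult \<sigma>_F) (simp add: \<sigma>_def)
  qed
qed

section \<open>Criteria in terms of signs at the roots\<close>

text \<open>A positive product means equal nonzero signs, which the sum then shares. Embeddings send
  \<open>\<theta>\<close> to roots, so a check at all roots suffices.\<close>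

lemma sig_decomposableI:
  fixes p q r p' q' r' :: int
  assumes \<theta>: "is_root a \<theta>"
    and \<beta>: "\<beta> = (\<lambda>t. of_int p + of_int q * t + of_int r * t\<^sup>2)"
    and \<gamma>: "\<gamma> = (\<lambda>t. of_int p' + of_int q' * t + of_int r' * t\<^sup>2)"
    and sgn: "\<And>t. is_root a t \<Longrightarrow> \<beta> t * \<gamma> t > 0"
  shows "sig_decomposable \<theta> (\<beta> \<theta> + \<gamma> \<theta>)"
proof -
  let ?S = "signature (Q_adjoin \<theta>)"
  have mem: "\<beta> \<theta> \<in> Z_adjoin \<theta>" "\<gamma> \<theta> \<in> Z_adjoin \<theta>"
    unfolding \<beta> \<gamma> by (auto intro!: Z_adjoin_add Z_adjoin_mult Z_adjoin_power)
  have nz: "\<beta> \<theta> \<noteq> 0" "\<gamma> \<theta> \<noteq> 0" "\<beta> \<theta> + \<gamma> \<theta> \<noteq> 0"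
    using sgn[OF \<theta>] by (auto simp: zero_less_mult_iff)
  have "sgn (\<sigma> (\<beta> \<theta>)) = sgn (\<sigma> (\<beta> \<theta> + \<gamma> \<theta>)) \<and> sgn (\<sigma> (\<gamma> \<theta>)) = sgn (\<sigma> (\<beta> \<theta> + \<gamma> \<theta>))"
    if \<sigma>: "\<sigma> \<in> real_embeddings (Q_adjoin \<theta>)" for \<sigma>
  proof -
    have "\<sigma> (\<beta> \<theta> + \<gamma> \<theta>) = \<sigma> (\<beta> \<theta>) + \<sigma> (\<gamma> \<theta>)"
      using mem Z_adjoin_subset_Q_adjoin by (intro embedding_add[OF \<sigma>]) auto
    moreover have "\<sigma> (\<beta> \<theta>) = \<beta> (\<sigma> \<theta>)" "\<sigma> (\<gamma> \<theta>) = \<gamma> (\<sigma> \<theta>)"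
      unfolding \<beta> \<gamma> by (rule embedding_quadratic[OF \<sigma>])+
    moreover have "\<beta> (\<sigma> \<theta>) * \<gamma> (\<sigma> \<theta>) > 0"
      by (intro sgn embedding_is_root[OF \<theta> \<sigma>])
    ultimately show ?thesis by (auto simp: zero_less_mult_iff)
  qed
  then have "?S (\<beta> \<theta>) = ?S (\<beta> \<theta> + \<gamma> \<theta>)" "?S (\<gamma> \<theta>) = ?S (\<beta> \<theta> + \<gamma> \<theta>)"
    unfolding signature_eq_iff by blast+
  then show ?thesis
    using mem nz unfolding sig_decomposable_def sig_indecomposable_def by blast
qed

text \<open>Linear independence lets coefficients be compared. Since every root is the image of
  \<open>\<theta>\<close> under some embedding, equal signatures give sign conditions at all
  roots.\<close>

lemma sig_indecomposableI:
  fixes p q r :: int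
  assumes "a \<ge> 3" and \<theta>: "is_root a \<theta>"
    and \<alpha>: "\<alpha> = (\<lambda>t. of_int p + of_int q * t + of_int r * t\<^sup>2)" and "\<alpha> \<theta> \<noteq> 0"
    and indec: "\<And>p' q' r' p'' q'' r'' :: int. p = p' + p'' \<Longrightarrow> q = q' + q'' \<Longrightarrow> r = r' + r'' \<Longrightarrow>
      (\<And>t. is_root a t \<Longrightarrow> sgn (of_int p' + of_int q' * t + of_int r' * t\<^sup>2) = sgn (\<alpha> t) \<and>
          sgn (of_int p'' + of_int q'' * t + of_int r'' * t\<^sup>2) = sgn (\<alpha> t)) \<Longrightarrow> False"
  shows "sig_indecomposable \<theta> (\<alpha> \<theta>)"
  unfolding sig_indecomposable_def
proof (intro conjI notI)
  show "\<alpha> \<theta> \<in> Z_adjoin \<theta> - {0}"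
    using assms(4) unfolding \<alpha> by (auto intro!: Z_adjoin_add Z_adjoin_mult Z_adjoin_power)
next
  let ?S = "signature (Q_adjoin \<theta>)"
  assume "\<exists>\<beta>\<in>Z_adjoin \<theta> - {0}. \<exists>\<gamma>\<in>Z_adjoin \<theta> - {0}. ?S \<beta> = ?S (\<alpha> \<theta>) \<and> ?S \<gamma> = ?S (\<alpha> \<theta>) \<and> \<alpha> \<theta> = \<beta> + \<gamma>"
  then obtain \<beta> \<gamma> where bg: "\<beta> \<in> Z_adjoin \<theta>" "\<gamma> \<in> Z_adjoin \<theta>" "?S \<beta> = ?S (\<alpha> \<theta>)" "?S \<gamma> = ?S (\<alpha> \<theta>)"
    "\<alpha> \<theta> = \<beta> + \<gamma>" by blast
  obtain p' q' r' :: int where \<beta>: "\<beta> = of_int p' + of_int q' * \<theta> + of_int r' * \<theta>\<^sup>2"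
    using is_root_Z_adjoinE[OF \<theta> bg(1)] .
  obtain p'' q'' r'' :: int where \<gamma>: "\<gamma> = of_int p'' + of_int q'' * \<theta> + of_int r'' * \<theta>\<^sup>2"
    using is_root_Z_adjoinE[OF \<theta> bg(2)] .
  have "of_int (p - p' - p'') + of_int (q - q' - q'') * \<theta> + of_int (r - r' - r'') * \<theta>\<^sup>2 = 0"
    using bg(5) unfolding \<alpha> \<beta> \<gamma> by (simp add: algebra_simps)
  from is_root_lin_indep[OF assms(1) \<theta> this]
  have "p = p' + p''" "q = q' + q''" "r = r' + r''" by auto
  moreover have "sgn (of_int p' + of_int q' * t + of_int r' * t\<^sup>2) = sgn (\<alpha> t) \<and>
          sgn (of_int p'' + of_int q'' * t + of_int r'' * t\<^sup>2) = sgn (\<alpha> t)" if t: "is_root a t" for t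
  proof -
    obtain \<sigma> where \<sigma>: "\<sigma> \<in> real_embeddings (Q_adjoin \<theta>)" "\<sigma> \<theta> = t"
      using embedding_exists[OF assms(1) \<theta> t] .
    have "sgn (\<sigma> \<beta>) = sgn (\<sigma> (\<alpha> \<theta>))" "sgn (\<sigma> \<gamma>) = sgn (\<sigma> (\<alpha> \<theta>))"
      using bg \<sigma> unfolding signature_eq_iff by blast+
    then show ?thesis
      unfolding \<beta> \<gamma> \<alpha> embedding_quadratic[OF \<sigma>(1)] \<sigma>(2) by simp
  qed
  ultimately show False using indec by blast
qed

section \<open>The three real roots: Vieta relations, bounds and trace forms\<close>

text \<open>The roots stand for \<open>\<rho>\<close>, \<open>\<rho>'\<close>,
  \<open>\<rho>''\<close> in the first family, and for \<open>1 + 1 / \<psi>\<close>,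
  \<open>1 + 1 / \<psi>'\<close>, \<open>1 + 1 / \<psi>''\<close> with the parameter lowered by 2 in
  the second.\<close>

locale cubic_roots =
  fixes a :: int and r1 r2 r3 :: real
  assumes a_ge: "a \<ge> 3"
    and root1: "is_root a r1" and root2: "is_root a r2" and root3: "is_root a r3"
    and r1_gt: "r1 > 1" and r2_gt: "r2 > - 1" and r2_neg: "r2 < 0" and r3_less: "r3 < - 1"
begin

lemma vieta_sum: "r1 + r2 + r3 = 1 - of_int a"
  and vieta_pairs: "r1 * r2 + r1 * r3 + r2 * r3 = - of_int a"
  and vieta_prod: "r1 * r2 * r3 = 1"
proof -
  \<comment> \<open>This is the divided difference of the cubic at two distinct roots; differencing
    once more isolates the sum of the roots.\<close>
  have quotient: "s\<^sup>2 + s * t + t\<^sup>2 + (of_int a - 1) * (s + t) - of_int a = 0"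
    if "is_root a s" "is_root a t" "s \<noteq> t" for s t
  proof -
    have "(s - t) * (s\<^sup>2 + s * t + t\<^sup>2 + (of_int a - 1) * (s + t) - of_int a) =
      (s ^ 3 + (of_int a - 1) * s\<^sup>2 - of_int a * s - 1) - (t ^ 3 + (of_int a - 1) * t\<^sup>2 - of_int a * t - 1)"
      by (simp add: algebra_simps power2_eq_square power3_eq_cube)
    also have "\<dots> = 0"
      by (simp only: that[unfolded is_root_def] diff_self)
    finally show ?thesis using that(3) by (simp only: mult_eq_0_iff) auto
  qed
  have 12: "r1\<^sup>2 + r1 * r2 + r2\<^sup>2 + (of_int a - 1) * (r1 + r2) - of_int a = 0"
    using r1_gt r2_neg by (intro quotient root1 root2) auto
  have 13: "r1\<^sup>2 + r1 * r3 + r3\<^sup>2 + (of_int a - 1) * (r1 + r3) - of_int a = 0"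
    using r1_gt r3_less by (intro quotient root1 root3) auto
  have "(r2 - r3) * (r1 + r2 + r3 + of_int a - 1) =
    (r1\<^sup>2 + r1 * r2 + r2\<^sup>2 + (of_int a - 1) * (r1 + r2) - of_int a) -
    (r1\<^sup>2 + r1 * r3 + r3\<^sup>2 + (of_int a - 1) * (r1 + r3) - of_int a)"
    by (simp add: algebra_simps power2_eq_square)
  then have zero: "r1 + r2 + r3 + of_int a - 1 = 0"
    using r2_gt r3_less 12 13 by simp
  then show sum: "r1 + r2 + r3 = 1 - of_int a" by simp
  have "r1 * r2 + r1 * r3 + r2 * r3 + of_int a = (r1 + r2) * (r1 + r2 + r3 + of_int a - 1) -
    (r1\<^sup>2 + r1 * r2 + r2\<^sup>2 + (of_int a - 1) * (r1 + r2) - of_int a)"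
    by (simp add: algebra_simps power2_eq_square)
  then show pairs: "r1 * r2 + r1 * r3 + r2 * r3 = - of_int a"
    using 12 zero by simp
  have "r1 * r2 * r3 = r1 ^ 3 - (r1 + r2 + r3) * r1\<^sup>2 + (r1 * r2 + r1 * r3 + r2 * r3) * r1"
    by (simp add: algebra_simps power2_eq_square power3_eq_cube)
  then show "r1 * r2 * r3 = 1"
    using root1 unfolding sum pairs is_root_def by (simp add: algebra_simps)
qed

lemma is_root_iff: "is_root a t \<longleftrightarrow> t = r1 \<or> t = r2 \<or> t = r3"
proof -
  have "(t - r1) * (t - r2) * (t - r3) =
    t ^ 3 - (r1 + r2 + r3) * t\<^sup>2 + (r1 * r2 + r1 * r3 + r2 * r3) * t - r1 * r2 * r3"
    by (simp add: algebra_simps power2_eq_square power3_eq_cube)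
  also have "\<dots> = t ^ 3 + (of_int a - 1) * t\<^sup>2 - of_int a * t - 1"
    unfolding vieta_sum vieta_pairs vieta_prod by (simp add: algebra_simps)
  finally have "is_root a t \<longleftrightarrow> (t - r1) * (t - r2) * (t - r3) = 0"
    by (simp add: is_root_def)
  then show ?thesis by simp
qed

text \<open>The cubic has the value \<open>- 1\<close> at 0 and at 1, so \<open>t\<close> and
  \<open>1 - t\<close> have polynomial inverses.\<close>

lemma root_identities:
  assumes "is_root a t"
  shows "t * (t\<^sup>2 + (of_int a - 1) * t - of_int a) = 1"
    and "(1 - t) * (- t * (t + of_int a)) = 1"
  using assms by (simp_all add: is_root_def power2_eq_square power3_eq_cube algebra_simps)

lemma r2_bounds: "- 1 / 2 < r2" "- r2 * (r2 + of_int a) < 1" "- r2 * (r2 + of_int a) > 1 / 2"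
proof -
  have id: "(1 - r2) * (- r2 * (r2 + of_int a)) = 1" by (rule root_identities[OF root2])
  then have "- r2 * (r2 + of_int a) = 1 / (1 - r2)"
    using r2_neg by (simp add: field_simps)
  moreover have "1 / (1 - r2) < 1" "1 / (1 - r2) > 1 / 2"
    using r2_neg r2_gt by (simp_all add: field_simps)
  ultimately show less: "- r2 * (r2 + of_int a) < 1" "- r2 * (r2 + of_int a) > 1 / 2" by simp_all
  have "real_of_int a \<ge> 3" using a_ge by simp
  then have "r2 + of_int a \<ge> 2" using r2_gt by simp
  then have "- r2 * (r2 + of_int a) \<ge> - r2 * 2"
    using r2_neg by (intro mult_left_mono) auto
  then show "- 1 / 2 < r2" using less by simp
qed

text \<open>Bootstrapping: \<open>r3 + a\<close> is the inverse of \<open>(1 - r3) * - r3\<close>.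
  The crude \<open>- r3 > 1\<close> gives \<open>- r3 > 5 / 2\<close>, which in turn gives the bound
  \<open>4 / 35 < 3 / 25\<close>.\<close>

lemma r3_bounds: "r3 + of_int a > 0" "r3 + of_int a < 3 / 25"
proof -
  have id: "(1 - r3) * (- r3 * (r3 + of_int a)) = 1" by (rule root_identities[OF root3])
  have pos: "(1 - r3) * - r3 > 0" using r3_less by (intro mult_pos_pos) auto
  have "((1 - r3) * - r3) * (r3 + of_int a) = 1" using id by (simp add: mult.assoc)
  with pos have eq: "r3 + of_int a = 1 / ((1 - r3) * - r3)"
    by (metis less_irrefl nonzero_mult_div_cancel_left)
  then show "r3 + of_int a > 0" using pos by simp
  have bound: "r3 + of_int a < 1 / (c * d)" if "c > 0" "d > 0" "1 - r3 > c" "- r3 > d" for c d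
  proof -
    have "(1 - r3) * - r3 > c * d" using that by (intro mult_strict_mono) auto
    then show ?thesis
      unfolding eq using that r3_less by (intro divide_strict_left_mono mult_pos_pos) auto
  qed
  have a: "real_of_int a \<ge> 3" using a_ge by simp
  from bound[of 2 1] r3_less have "r3 + of_int a < 1 / 2" by simp
  with a have "- r3 > 5 / 2" by simp
  then have "r3 + of_int a < 1 / (7 / 2 * (5 / 2))" by (intro bound) auto
  then show "r3 + of_int a < 3 / 25" by simp
qed

lemma r1_bounds: "(r1 - 1) * (of_int a + 1) < 1" "r1 < 5 / 4"
proof -
  have a: "real_of_int a \<ge> 3" using a_ge by simp
  \<comment> \<open>The cubic expanded around 1: all coefficients but the constant one are
    positive.\<close>
  have "(r1 - 1) * ((r1 - 1)\<^sup>2 + (of_int a + 2) * (r1 - 1) + (of_int a + 1)) = 1"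
    using root1 by (simp add: is_root_def power2_eq_square power3_eq_cube algebra_simps)
  moreover have "(r1 - 1) * (of_int a + 1) < (r1 - 1) * ((r1 - 1)\<^sup>2 + (of_int a + 2) * (r1 - 1) + (of_int a + 1))"
    using r1_gt a by (intro mult_strict_left_mono) (auto intro!: add_pos_pos mult_pos_pos)
  ultimately show *: "(r1 - 1) * (of_int a + 1) < 1" by simp
  have "(r1 - 1) * (of_int a + 1) \<ge> (r1 - 1) * 4"
    using r1_gt a by (intro mult_left_mono) auto
  with * show "r1 < 5 / 4" by simp
qed

text \<open>
  Lagrange interpolation at the three roots with denominators cleared. By Vieta,
  \<open>r\<^sub>j r\<^sub>k + k\<close> is \<open>1 / r\<^sub>i + k\<close>, so this is a trace form on \<open>\<int>[\<theta>]\<close> whose weights have known signs.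
\<close>
lemma interpolation:
  fixes p q r k :: real
  assumes f: "f = (\<lambda>t. p + q * t + r * t\<^sup>2)"
  shows "(r1 - r2) * (r1 - r3) * (r2 - r3) * (p + k * r) =
    f r1 * (r2 * r3 + k) * (r2 - r3) + f r2 * - (r1 * r3 + k) * (r1 - r3) + f r3 * (r1 * r2 + k) * (r1 - r2)"
  unfolding f by (simp add: algebra_simps power2_eq_square)

text \<open>The case \<open>k = 0\<close> of \<open>interpolation\<close>: the weights have signs
  \<open>+, +, -\<close>, so all three terms are positive.\<close>

lemma constant_coeff_pos:
  fixes p q r :: int
  assumes f: "f = (\<lambda>t. of_int p + of_int q * t + of_int r * t\<^sup>2)" and signs: "f r1 > 0" "f r2 > 0" "f r3 < 0"
  shows "p > 0"
proof -
  have prods: "r2 * r3 > 0" "r1 * r3 < 0" "r1 * r2 < 0"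
    using r1_gt r2_neg r3_less by (simp_all add: mult_neg_neg mult_pos_neg)
  have "f r1 * (r2 * r3) * (r2 - r3) > 0"
    using r2_gt r3_less by (intro mult_pos_pos[OF mult_pos_pos[OF signs(1) prods(1)]]) auto
  moreover have "f r2 * - (r1 * r3) * (r1 - r3) > 0"
    using signs prods r1_gt r3_less by (intro mult_pos_pos) auto
  moreover have "f r3 * (r1 * r2) * (r1 - r2) > 0"
    using r1_gt r2_neg by (intro mult_pos_pos[OF mult_neg_neg[OF signs(3) prods(3)]]) auto
  ultimately have "(r1 - r2) * (r1 - r3) * (r2 - r3) * of_int p > 0"
    using interpolation[OF f, of 0] by simp
  moreover have "(r1 - r2) * (r1 - r3) * (r2 - r3) > 0"
    using r1_gt r2_gt r2_neg r3_less by (intro mult_pos_pos) auto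
  ultimately show ?thesis using zero_less_mult_pos of_int_0_less_iff by blast
qed

text \<open>The weights carry \<open>1 / r1 + k\<close>, \<open>- (1 / r2 + k)\<close> and
  \<open>1 / r3 + k\<close>. They are positive because \<open>1 / r2 < - 2\<close> and
  \<open>1 / r3 > - 1\<close>, whence the range of \<open>k\<close>.\<close>

lemma totally_positive_coeffs:
  fixes p q r k :: int
  assumes f: "f = (\<lambda>t. of_int p + of_int q * t + of_int r * t\<^sup>2)" and signs: "f r1 > 0" "f r2 > 0" "f r3 > 0"
    and k: "1 \<le> k" "k \<le> 2"
  shows "p + k * r > 0"
proof -
  have k': "1 \<le> real_of_int k" "real_of_int k \<le> 2" using k by auto
  have prods: "r2 * r3 > 0" "r1 * r3 < - 2" "r1 * r2 > - 1"
  proof -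
    show "r2 * r3 > 0" using r2_neg r3_less by (intro mult_neg_neg) auto
    have "r1 * r3 = 1 / r2" using vieta_prod r2_neg by (simp add: field_simps)
    moreover have "1 / r2 < - 2" using r2_bounds(1) r2_neg by (simp add: field_simps)
    ultimately show "r1 * r3 < - 2" by simp
    have "r1 * r2 = 1 / r3" using vieta_prod r3_less by (simp add: field_simps)
    moreover have "1 / r3 > - 1" using r3_less by (simp add: field_simps)
    ultimately show "r1 * r2 > - 1" by simp
  qed
  have "f r1 * (r2 * r3 + of_int k) * (r2 - r3) > 0"
    using signs prods k' r2_gt r3_less by (intro mult_pos_pos) auto
  moreover have "f r2 * - (r1 * r3 + of_int k) * (r1 - r3) > 0"
    using signs prods k' r1_gt r3_less by (intro mult_pos_pos) auto
  moreover have "f r3 * (r1 * r2 + of_int k) * (r1 - r2) > 0"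
    using signs prods k' r1_gt r2_neg by (intro mult_pos_pos) auto
  ultimately have "(r1 - r2) * (r1 - r3) * (r2 - r3) * of_int (p + k * r) > 0"
    using interpolation[OF f, of "of_int k"] by simp
  moreover have "(r1 - r2) * (r1 - r3) * (r2 - r3) > 0"
    using r1_gt r2_gt r2_neg r3_less by (intro mult_pos_pos) auto
  ultimately show ?thesis using zero_less_mult_pos of_int_0_less_iff by blast
qed

lemma triangle_signs:
  fixes p q :: int
  assumes q: "0 \<le> q" "q \<le> p" and p: "1 \<le> p" "p \<le> a" "p = a \<Longrightarrow> q \<le> a - 2"
  shows "1 + of_int p * r1 - of_int q * r1\<^sup>2 > 0" "1 + of_int p * r2 - of_int q * r2\<^sup>2 > 0"
    "1 + of_int p * r3 - of_int q * r3\<^sup>2 < 0"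
proof -
  have a: "real_of_int a \<ge> 3" using a_ge by simp
  have "of_int p * r3 \<le> 1 * r3" using p r3_less by (intro mult_right_mono_neg) auto
  moreover have "of_int q * r3\<^sup>2 \<ge> 0" using q by simp
  ultimately show "1 + of_int p * r3 - of_int q * r3\<^sup>2 < 0" using r3_less by linarith
  have *: "1 + of_int p * r1 - of_int q * r1\<^sup>2 > 0 \<and> 1 + of_int p * r2 - of_int q * r2\<^sup>2 > 0"
  proof (cases "p = a")
    case True
    \<comment> \<open>On the side \<open>p = a\<close> the cubic replaces \<open>1 + a * t\<close>
      by \<open>t ^ 3 + (a - 1) * t\<^sup>2\<close>.\<close>
    have eq: "1 + of_int p * t - of_int q * t\<^sup>2 = t\<^sup>2 * (t + of_int (a - 1 - q))" if "is_root a t" for t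
      using that True by (simp add: is_root_def power2_eq_square power3_eq_cube algebra_simps)
    have "real_of_int (a - 1 - q) \<ge> 1" using p True by simp
    then show ?thesis
      unfolding eq[OF root1] eq[OF root2] using r1_gt r2_gt r2_neg by (auto intro!: mult_pos_pos)
  next
    case False
    then have pa: "real_of_int p \<le> of_int a - 1" using p by linarith
    have key: "(of_int a - 1) * (t\<^sup>2 - t) = 1 + t - t ^ 3" if "is_root a t" for t
      using that by (simp add: is_root_def algebra_simps)
    \<comment> \<open>Enlarging \<open>q\<close> to \<open>p\<close> and then \<open>p\<close> to
      \<open>a - 1\<close> only lowers the value; at that corner the cubic turns it into
      \<open>t ^ 3 - t\<close>.\<close>
    have bound: "1 + of_int p * t - of_int q * t\<^sup>2 \<ge> t ^ 3 - t" if "is_root a t" "t\<^sup>2 - t \<ge> 0" for t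
    proof -
      have "of_int q * t\<^sup>2 \<le> of_int p * t\<^sup>2" using q by (intro mult_right_mono) auto
      moreover have "of_int p * (t\<^sup>2 - t) \<le> (of_int a - 1) * (t\<^sup>2 - t)"
        using pa that by (intro mult_right_mono) auto
      ultimately show ?thesis using key[OF that(1)] by (simp add: algebra_simps)
    qed
    have "r1 ^ 3 - r1 = r1 * ((r1 - 1) * (r1 + 1))" "r2 ^ 3 - r2 = - r2 * ((1 - r2) * (r2 + 1))"
      by (simp_all add: algebra_simps power3_eq_cube)
    then have "r1 ^ 3 - r1 > 0" "r2 ^ 3 - r2 > 0"
      using r1_gt r2_neg r2_gt by (auto intro!: mult_pos_pos simp del: mult_minus_left)
    moreover have "r1\<^sup>2 - r1 \<ge> 0" "r2\<^sup>2 - r2 \<ge> 0"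
      using r1_gt r2_neg by (simp_all add: power2_eq_square)
    ultimately show ?thesis using bound[OF root1] bound[OF root2] by linarith
  qed
  then show "1 + of_int p * r1 - of_int q * r1\<^sup>2 > 0" "1 + of_int p * r2 - of_int q * r2\<^sup>2 > 0" by auto
qed

section \<open>Indecomposables of the cubic order\<close>

context
  fixes \<theta> :: real
  assumes \<theta>: "is_root a \<theta>"
begin

lemma is_unit_root: "is_unit \<theta> \<theta>"
  by (rule is_unitI[OF _ _ root_identities(1)[OF \<theta>]])
     (auto intro!: Z_adjoin_add Z_adjoin_diff Z_adjoin_mult Z_adjoin_power)

lemma is_unit_one_minus_root: "is_unit \<theta> (1 - \<theta>)"
  by (rule is_unitI[OF _ _ root_identities(2)[OF \<theta>]])
     (auto intro!: Z_adjoin_add Z_adjoin_diff Z_adjoin_mult Z_adjoin_uminus)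

text \<open>On totally positive elements \<open>p + r\<close> is a positive integer, and it equals 1
  here, so it cannot be split.\<close>

lemma sig_indecomposable_one: "sig_indecomposable \<theta> 1"
proof -
  have "sig_indecomposable \<theta> ((\<lambda>t. of_int 1 + of_int 0 * t + of_int 0 * t\<^sup>2) \<theta>)"
  proof (rule sig_indecomposableI[OF a_ge \<theta> refl])
    fix p q r p' q' r' :: int
    assume eq: "1 = p + p'" "0 = q + q'" "0 = r + r'"
      and sgn: "\<And>t :: real. is_root a t \<Longrightarrow>
        sgn (of_int p + of_int q * t + of_int r * t\<^sup>2) = sgn (of_int 1 + of_int 0 * t + of_int 0 * t\<^sup>2) \<and>
        sgn (of_int p' + of_int q' * t + of_int r' * t\<^sup>2) = sgn (of_int 1 + of_int 0 * t + of_int 0 * t\<^sup>2)"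
    have "p + 1 * r > 0"
      by (rule totally_positive_coeffs[OF refl]) (use sgn root1 root2 root3 in \<open>auto simp: sgn_1_pos\<close>)
    moreover have "p' + 1 * r' > 0"
      by (rule totally_positive_coeffs[OF refl]) (use sgn root1 root2 root3 in \<open>auto simp: sgn_1_pos\<close>)
    ultimately show False using eq by linarith
  qed simp
  then show ?thesis by simp
qed

lemma sig_indecomposable_unit: "is_unit \<theta> u \<Longrightarrow> sig_indecomposable \<theta> u"
  using sig_indecomposable_unit_mult[OF _ sig_indecomposable_one, of u] by simp

text \<open>
  This element has minimal trace 2: both trace forms bound its decompositions, and they leave only
  \<open>2 - \<theta> = (1 + q\<theta>) + (1 - (q + 1)\<theta>)\<close>, where one summand is negative at the root \<open>r\<^sub>1 > 1\<close>.
\<close>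
lemma sig_indecomposable_two_minus: "sig_indecomposable \<theta> (2 - \<theta>)"
proof -
  have pos: "2 - t > 0" if "is_root a t" for t
    using that r1_bounds(2) r2_neg r3_less unfolding is_root_iff by auto
  have "sig_indecomposable \<theta> ((\<lambda>t. of_int 2 + of_int (- 1) * t + of_int 0 * t\<^sup>2) \<theta>)"
  proof (rule sig_indecomposableI[OF a_ge \<theta> refl])
    fix p q r p' q' r' :: int
    assume eq: "2 = p + p'" "- 1 = q + q'" "0 = r + r'"
      and sgn: "\<And>t :: real. is_root a t \<Longrightarrow>
        sgn (of_int p + of_int q * t + of_int r * t\<^sup>2) = sgn (of_int 2 + of_int (- 1) * t + of_int 0 * t\<^sup>2) \<and>
        sgn (of_int p' + of_int q' * t + of_int r' * t\<^sup>2) = sgn (of_int 2 + of_int (- 1) * t + of_int 0 * t\<^sup>2)"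
    have sgn': "of_int p + of_int q * t + of_int r * t\<^sup>2 > 0 \<and> of_int p' + of_int q' * t + of_int r' * t\<^sup>2 > 0"
      if "is_root a t" for t
      using sgn[OF that] pos[OF that] by (simp add: sgn_1_pos)
    have "p + k * r > 0" "p' + k * r' > 0"
      if "1 \<le> k" "k \<le> 2" for k :: int
      by (rule totally_positive_coeffs[OF refl]; use sgn' root1 root2 root3 that in blast)+
    \<comment> \<open>For \<open>k = 1\<close> and \<open>k = 2\<close> the two positive integers
      add up to 2, so each is 1; comparing the two forms gives \<open>r = r' = 0\<close>.\<close>
    from this[of 1] this[of 2] have "p + r > 0" "p' + r' > 0" "p + 2 * r > 0" "p' + 2 * r' > 0"
      by linarith+
    with eq have "p = 1" "r = 0" "p' = 1" "r' = 0" by linarith+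
    with sgn'[OF root1] have *: "1 + of_int q * r1 > 0" "1 + of_int q' * r1 > 0" by auto
    have "q \<le> - 1 \<or> q' \<le> - 1" using eq by linarith
    then have "of_int q \<le> (- 1 :: real) \<or> of_int q' \<le> (- 1 :: real)" by linarith
    then have "of_int q * r1 \<le> - 1 * r1 \<or> of_int q' * r1 \<le> - 1 * r1"
      using r1_gt by (meson mult_right_mono less_imp_le less_trans zero_less_one)
    with * r1_gt show False by linarith
  qed (use pos[OF \<theta>] in simp)
  then show ?thesis by simp
qed

text \<open>By \<open>triangle_signs\<close> the signature is the one on which the constant
  coefficient is positive, and here it has the least possible value 1.\<close>

lemma sig_indecomposable_triangle:
  fixes p q :: int
  assumes q: "0 \<le> q" "q \<le> p" and p: "1 \<le> p" "p \<le> a" "p = a \<Longrightarrow> q \<le> a - 2"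
  shows "sig_indecomposable \<theta> (1 + of_int p * \<theta> - of_int q * \<theta>\<^sup>2)"
proof -
  note signs = triangle_signs[OF assms]
  have "sig_indecomposable \<theta> ((\<lambda>t. of_int 1 + of_int p * t + of_int (- q) * t\<^sup>2) \<theta>)"
  proof (rule sig_indecomposableI[OF a_ge \<theta> refl])
    show "of_int 1 + of_int p * \<theta> + of_int (- q) * \<theta>\<^sup>2 \<noteq> 0"
      using signs \<theta> unfolding is_root_iff by auto
  next
    fix p1 q1 r1' p2 q2 r2' :: int
    assume eq: "1 = p1 + p2"
      and sgn: "\<And>t :: real. is_root a t \<Longrightarrow>
        sgn (of_int p1 + of_int q1 * t + of_int r1' * t\<^sup>2) = sgn (of_int 1 + of_int p * t + of_int (- q) * t\<^sup>2) \<and>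
        sgn (of_int p2 + of_int q2 * t + of_int r2' * t\<^sup>2) = sgn (of_int 1 + of_int p * t + of_int (- q) * t\<^sup>2)"
    have *: "of_int p1 + of_int q1 * r1 + of_int r1' * r1\<^sup>2 > 0" "of_int p2 + of_int q2 * r1 + of_int r2' * r1\<^sup>2 > 0"
      "of_int p1 + of_int q1 * r2 + of_int r1' * r2\<^sup>2 > 0" "of_int p2 + of_int q2 * r2 + of_int r2' * r2\<^sup>2 > 0"
      "of_int p1 + of_int q1 * r3 + of_int r1' * r3\<^sup>2 < 0" "of_int p2 + of_int q2 * r3 + of_int r2' * r3\<^sup>2 < 0"
      using sgn[OF root1] sgn[OF root2] sgn[OF root3] signs by (simp_all add: sgn_1_pos sgn_1_neg)
    have "p1 > 0" "p2 > 0"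
      by (rule constant_coeff_pos[OF refl]; use * in blast)+
    with eq show False by simp
  qed
  then show ?thesis by simp
qed

end

end

section \<open>Cycles of the expansions\<close>

text \<open>A local certificate for one vertex of a closed graph of vectors modulo units.\<close>

definition jp_node :: "real \<Rightarrow> (real \<times> real \<times> real) set \<Rightarrow> real \<times> real \<times> real \<Rightarrow> bool" where
  "jp_node \<theta> W w \<longleftrightarrow> (\<exists>w'\<in>W. \<exists>u. is_unit \<theta> u \<and> jp_step w = scale3 u w') \<and>
     (\<forall>\<alpha>\<in>vector_semiconvergents w. sig_indecomposable \<theta> \<alpha>)"

text \<open>The inequalities certify \<open>b\<close> and \<open>c\<close> as the partial quotients;
  \<open>u\<close> and \<open>w'\<close> are the edge to the next vertex.\<close>

lemma jp_nodeI:
  assumes "x > 0"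
    and y: "of_int b * x \<le> y" "y < (of_int b + 1) * x"
    and z: "of_int c * x \<le> z" "z < (of_int c + 1) * x"
    and w': "w' \<in> W" "is_unit \<theta> u" "(y - of_int b * x, z - of_int c * x, x) = scale3 u w'"
    and indec: "\<And>j. 0 \<le> j \<Longrightarrow> j < b \<Longrightarrow> sig_indecomposable \<theta> (y - of_int j * x)"
      "\<And>j. 0 \<le> j \<Longrightarrow> j < c \<Longrightarrow> sig_indecomposable \<theta> (z - of_int j * x)"
  shows "jp_node \<theta> W (x, y, z)"
proof -
  have "\<lfloor>y / x\<rfloor> = b" "\<lfloor>z / x\<rfloor> = c"
    using \<open>x > 0\<close> y z by (auto simp: floor_eq_iff pos_le_divide_eq pos_divide_less_eq)
  then show ?thesis
    using w' indec by (auto simp: jp_node_def jp_step_def vector_semiconvergents_def)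
qed

lemma sig_indecomposable_nodes:
  assumes "\<And>w. w \<in> W \<Longrightarrow> jp_node \<theta> W w" "v \<in> W" "\<alpha> \<in> jp_semiconvergents v"
  shows "sig_indecomposable \<theta> \<alpha>"
  using sig_indecomposable_semiconvergents[of v W \<theta> \<alpha>] assms unfolding jp_node_def by blast

section \<open>Indecomposables that occur along the expansions\<close>

context cubic_roots
begin

text \<open>Here \<open>e = - 1 / \<theta>\<close> and \<open>\<kappa> = 1 / (1 - \<theta>)\<close>, written as polynomials in \<open>\<theta>\<close>.\<close>
context
  fixes \<theta> e \<kappa> :: real
  assumes \<theta>: "is_root a \<theta>"
    and e_def: "e = of_int a - (of_int a - 1) * \<theta> - \<theta>\<^sup>2"
    and \<kappa>_def: "\<kappa> = - \<theta> * (\<theta> + of_int a)"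
begin

lemma root_eq: "\<theta> ^ 3 + (of_int a - 1) * \<theta>\<^sup>2 - of_int a * \<theta> - 1 = 0"
  using \<theta> by (simp add: is_root_def)

lemma e_eq: "\<theta> * e = - 1" and \<kappa>_eq: "(1 - \<theta>) * \<kappa> = 1"
  using root_eq unfolding e_def \<kappa>_def by Groebner_Basis.algebra+

lemma e_\<kappa>: "e = of_int a + \<theta> + \<kappa>"
  unfolding e_def \<kappa>_def by (simp add: algebra_simps power2_eq_square)

lemma units: "is_unit \<theta> \<theta>" "is_unit \<theta> (1 - \<theta>)" "is_unit \<theta> e" "is_unit \<theta> \<kappa>"
proof -
  show th: "is_unit \<theta> \<theta>" and om: "is_unit \<theta> (1 - \<theta>)"
    by (rule is_unit_root[OF \<theta>], rule is_unit_one_minus_root[OF \<theta>])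
  have nz: "\<theta> \<noteq> 0" "1 - \<theta> \<noteq> 0" using e_eq \<kappa>_eq by auto
  then have "e = - inverse \<theta>" "\<kappa> = inverse (1 - \<theta>)"
    using e_eq \<kappa>_eq by (simp_all add: field_simps)
  then show "is_unit \<theta> e" "is_unit \<theta> \<kappa>"
    using is_unit_uminus[OF is_unit_inverse[OF th]] is_unit_inverse[OF om] by simp_all
qed

lemma sig_indecomposable_triangle_multiple:
  fixes p q :: int
  assumes "is_unit \<theta> u" "\<alpha> = u * (1 + of_int p * \<theta> - of_int q * \<theta>\<^sup>2)"
    and "0 \<le> q" "q \<le> p" "1 \<le> p" "p \<le> a" "p = a \<Longrightarrow> q \<le> a - 2"
  shows "sig_indecomposable \<theta> \<alpha>"
  unfolding assms(2)
  by (rule sig_indecomposable_unit_mult[OF assms(1) sig_indecomposable_triangle[OF \<theta> assms(3-)]])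

text \<open>The row \<open>q = 0\<close> of the triangle; \<open>j = 0\<close> lies outside it and
  gives the unit itself.\<close>

lemma indec_linear:
  assumes "0 \<le> j" "j < a" "is_unit \<theta> u" "\<alpha> = u * (1 + of_int j * \<theta>)"
  shows "sig_indecomposable \<theta> \<alpha>"
proof (cases "j = 0")
  case True
  then show ?thesis using assms sig_indecomposable_unit[OF \<theta>] by simp
next
  case False
  then show ?thesis using assms
    by (intro sig_indecomposable_triangle_multiple[of u _ j 0]) auto
qed

text \<open>Multiplication by \<open>\<theta>\<^sup>2\<close>, the inverse of \<open>e * e\<close>,
  leads to the side \<open>p = a\<close> of the triangle.\<close>

lemma indec_root_plus:
  assumes "0 \<le> j" "j \<le> a - 2"
  shows "sig_indecomposable \<theta> (of_int a - 1 + \<theta> - of_int j)"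
proof (rule sig_indecomposable_triangle_multiple[of "e * e" _ a j])
  show "of_int a - 1 + \<theta> - of_int j = e * e * (1 + of_int a * \<theta> - of_int j * \<theta>\<^sup>2)"
    using e_eq root_eq by Groebner_Basis.algebra
qed (use assms a_ge units in auto)

lemma indec_e_minus:
  assumes "0 \<le> j" "j < a"
  shows "sig_indecomposable \<theta> (e - of_int j)"
proof (rule indec_linear[OF assms units(3)])
  show "e - of_int j = e * (1 + of_int j * \<theta>)"
    using e_eq by Groebner_Basis.algebra
qed

text \<open>The row \<open>q = 1\<close> of the triangle; for \<open>j = 0\<close> the element
  factors as \<open>(1 - \<theta>) * (1 + \<theta>)\<close>.\<close>

lemma indec_one_minus_square_plus:
  assumes "0 \<le> j" "j < a"
  shows "sig_indecomposable \<theta> (1 - \<theta>\<^sup>2 + of_int j * \<theta>)"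
proof (cases "j = 0")
  case True
  then show ?thesis
    by (intro indec_linear[of 1 "1 - \<theta>"]) (use a_ge units in \<open>auto simp: algebra_simps power2_eq_square\<close>)
next
  case False
  then show ?thesis
    by (intro sig_indecomposable_triangle_multiple[of 1 _ j 1]) (use assms a_ge in auto)
qed

text \<open>The values \<open>j = 0, 1\<close> give the units \<open>1 - \<theta>\<close> and
  \<open>- \<theta>\<close>; from 2 on these are the negatives of the elements in
  \<open>indec_root_plus\<close>.\<close>

lemma indec_one_minus_root_minus:
  assumes "0 \<le> j" "j \<le> a"
  shows "sig_indecomposable \<theta> (1 - \<theta> - of_int j)"
proof -
  consider "j = 0" | "j = 1" | "2 \<le> j" using assms by linarith
  then show ?thesis
  proof cases
    case 1
    then show ?thesis using sig_indecomposable_unit[OF \<theta> units(2)] by simp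
  next
    case 2
    then show ?thesis using sig_indecomposable_unit[OF \<theta> is_unit_uminus[OF units(1)]] by simp
  next
    case 3
    then have "sig_indecomposable \<theta> (- 1 * (of_int a - 1 + \<theta> - of_int (a - j)))"
      using assms is_unit_uminus[OF is_unit_1]
      by (intro sig_indecomposable_unit_mult indec_root_plus) auto
    moreover have "- 1 * (of_int a - 1 + \<theta> - of_int (a - j)) = 1 - \<theta> - of_int j" by simp
    ultimately show ?thesis by (simp only:)
  qed
qed

text \<open>Division by \<open>- e\<close> handles \<open>j = 0, 1\<close>; for larger
  \<open>j\<close>, division by \<open>- (e * e)\<close> leads to the line \<open>p = a - 1\<close>
  of the triangle.\<close>

lemma indec_one_minus_root_minus_e:
  assumes "0 \<le> j" "j < a"
  shows "sig_indecomposable \<theta> (1 - \<theta> - e - of_int j)"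
proof -
  have ue: "is_unit \<theta> (- e)" "is_unit \<theta> (- (e * e))" using units by auto
  consider "j = 0" | "j = 1" | "2 \<le> j" using assms by linarith
  then show ?thesis
  proof cases
    case 1
    have "1 - \<theta> - e = - e * (1 + \<theta> - \<theta>\<^sup>2)"
      using e_eq by Groebner_Basis.algebra
    then show ?thesis
      using 1 a_ge ue by (intro sig_indecomposable_triangle_multiple[of "- e" _ 1 1]) auto
  next
    case 2
    have "- e * (1 - \<theta>\<^sup>2) = 1 - \<theta> - e - 1"
      using e_eq by Groebner_Basis.algebra
    then show ?thesis
      using 2 a_ge ue sig_indecomposable_unit_mult[OF ue(1) indec_one_minus_square_plus[of 0]] by simp
  next
    case 3
    have "1 - \<theta> - e - of_int j = - (e * e) * (1 + of_int (a - 1) * \<theta> - of_int (a - j) * \<theta>\<^sup>2)"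
      using e_eq root_eq unfolding of_int_diff of_int_1 by Groebner_Basis.algebra
    then show ?thesis
      using a_ge assms 3 ue
      by (intro sig_indecomposable_triangle_multiple[of "- (e * e)" _ "a - 1" "a - j"]) auto
  qed
qed

end

section \<open>The expansions of part (1)\<close>

text \<open>At the root \<open>r2\<close> the first vector is that of \<open>\<rho>'\<close>, the
  second that of \<open>\<psi>'\<close>. Both run into the same cycle, so one set of vectors serves
  both.\<close>

lemma r2_expansions:
  fixes t e \<kappa> :: real
  assumes t: "t = r2"
    and e_def: "e = of_int a - (of_int a - 1) * t - t\<^sup>2"
    and \<kappa>_def: "\<kappa> = - t * (t + of_int a)"
    and \<alpha>: "\<alpha> \<in> jp_semiconvergents (1, - t, t\<^sup>2) \<or> \<alpha> \<in> jp_semiconvergents (1, \<kappa>, \<kappa>\<^sup>2)"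
  shows "sig_indecomposable t \<alpha>"
proof -
  have root: "is_root a t" using root2 t by simp
  note eqs = root_eq[OF root e_def \<kappa>_def] e_eq[OF root e_def \<kappa>_def] \<kappa>_eq[OF root e_def \<kappa>_def]
    e_\<kappa>[OF root e_def \<kappa>_def]
  note units = units[OF root e_def \<kappa>_def]
  note triangle = sig_indecomposable_triangle_multiple[OF root e_def \<kappa>_def]
  note unit = sig_indecomposable_unit[OF root] and one = sig_indecomposable_one[OF root]
  note linear = indec_linear[OF root e_def \<kappa>_def]
  note root_plus = indec_root_plus[OF root e_def \<kappa>_def]
  note e_minus = indec_e_minus[OF root e_def \<kappa>_def]
  note square = indec_one_minus_square_plus[OF root e_def \<kappa>_def]
  have A: "real_of_int a \<ge> 3" using a_ge by simp
  have \<kappa>: "\<kappa> < 1" "\<kappa> > 1 / 2" using r2_bounds t by (simp_all add: \<kappa>_def)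
  have t_bounds: "t < 0" "t > - 1 / 2" using r2_neg r2_bounds t by auto
  have "t * t \<le> t * (- 1 / 2)" using t_bounds by (intro mult_left_mono_neg) auto
  then have t2: "0 < t\<^sup>2" "t\<^sup>2 \<le> - t / 2" "t\<^sup>2 < 1 / 4"
    using t_bounds by (simp, simp_all add: power2_eq_square)
  have \<kappa>_t: "\<kappa> \<ge> - 2 * t"
  proof -
    have "- t * 2 \<le> - t * (t + of_int a)" using t_bounds A by (intro mult_left_mono) auto
    then show ?thesis by (simp add: \<kappa>_def)
  qed
  \<comment> \<open>The bounds on \<open>\<kappa>\<close> give \<open>a < e < a + 1\<close> and
    \<open>e \<ge> a - t\<close>, and \<open>- t\<close> is \<open>1 / e\<close>. The sharper third
    inequality serves the partial quotient of \<open>1 - t\<^sup>2\<close> by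
    \<open>- t\<close>.\<close>
  have "of_int a * (- t) < e * (- t)" "(of_int a + 1) * (- t) > e * (- t)" "(of_int a - t) * (- t) \<le> e * (- t)"
    using t_bounds \<kappa> \<kappa>_t eqs(4) by (auto intro!: mult_strict_right_mono mult_right_mono)
  moreover have "e * (- t) = 1" using eqs(2) by (simp add: mult.commute)
  ultimately have a_t: "of_int a * (- t) < 1" "(of_int a + 1) * (- t) > 1" "(of_int a - t) * (- t) \<le> 1"
    by simp_all
  \<comment> \<open>So \<open>1 / (t\<^sup>2 - t)\<close> lies between \<open>a - 1\<close> and
    \<open>a\<close>, which gives the partial quotient \<open>a - 1\<close> at the last vector of
    \<open>W\<close>.\<close>
  have "(t\<^sup>2 - t) * (t + of_int a) = 1" using eqs(1) by Groebner_Basis.algebra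
  moreover have pos: "t\<^sup>2 - t > 0" using t_bounds t2 by linarith
  moreover have "(t\<^sup>2 - t) * (t + of_int a) < (t\<^sup>2 - t) * of_int a" "(t\<^sup>2 - t) * (of_int a - 1) \<le> (t\<^sup>2 - t) * (t + of_int a)"
    using t_bounds pos by (auto intro!: mult_strict_left_mono mult_left_mono)
  ultimately have a_t2: "(t\<^sup>2 - t) * of_int a > 1" "(t\<^sup>2 - t) * (of_int a - 1) \<le> 1" by simp_all
  note bounds = A \<kappa> t_bounds t2(2,3) pos \<kappa>_t a_t a_t2 eqs(4)
  \<comment> \<open>The first ten vectors are the terms of the expansion of \<open>(1, - t, t\<^sup>2)\<close> divided by units; the tenth
    leads back to the fourth. The other four start the expansion of \<open>(1, \<kappa>, \<kappa>\<^sup>2)\<close> and lead to the seventh.\<close>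
  define W :: "(real \<times> real \<times> real) set" where
    "W = {(1, - t, t\<^sup>2), (- t, t\<^sup>2, 1), (1, of_int a - 1 + t, e), (1 + t, e - of_int a, 1),
      (of_int a - 1 + t, 1, e - 1), (1, e - of_int a - t, of_int a - 1 + t), (1, 1 - t\<^sup>2, 1 - t), (1 - t\<^sup>2, - t, 1),
      (- t, t\<^sup>2, 1 - t\<^sup>2), (1, of_int a - 2 + t, e),
      (1, \<kappa>, \<kappa>\<^sup>2), (1 - t, 1, (1 - t)\<^sup>2), (1, t\<^sup>2 - t, 1 - t), (t\<^sup>2 - t, - t, 1)}"
  have 0: "jp_node t W (1, - t, t\<^sup>2)"
  proof (rule jp_nodeI[where b = 0 and c = 0 and u = 1 and w' = "(- t, t\<^sup>2, 1)"])
  qed (use bounds in \<open>auto simp: W_def scale3_def\<close>)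
  have 1: "jp_node t W (- t, t\<^sup>2, 1)"
  proof (rule jp_nodeI[where b = 0 and c = a and u = "t\<^sup>2" and w' = "(1, of_int a - 1 + t, e)"])
    \<comment> \<open>The unit divided out is the new first entry \<open>t\<^sup>2\<close>.\<close>
    have "t\<^sup>2 * (of_int a - 1 + t) = 1 + of_int a * t" "t\<^sup>2 * e = - t"
      using eqs(1,2) by Groebner_Basis.algebra+
    then show "(t\<^sup>2 - of_int 0 * - t, 1 - of_int a * - t, - t) = scale3 (t\<^sup>2) (1, of_int a - 1 + t, e)"
      by (simp add: scale3_def)
    show "sig_indecomposable t (1 - of_int j * - t)" if "0 \<le> j" "j < a" for j
      using linear[OF that, of 1] by auto
  qed (use bounds units in \<open>auto simp: W_def algebra_simps\<close>)
  have 2: "jp_node t W (1, of_int a - 1 + t, e)"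
  proof (rule jp_nodeI[where b = "a - 2" and c = a and u = 1 and w' = "(1 + t, e - of_int a, 1)"])
    show "sig_indecomposable t (of_int a - 1 + t - of_int j * 1)" if "0 \<le> j" "j < a - 2" for j
      using root_plus[of j] that by simp
    show "sig_indecomposable t (e - of_int j * 1)" if "0 \<le> j" "j < a" for j
      using e_minus[of j] that by simp
  qed (use bounds in \<open>auto simp: W_def scale3_def\<close>)
  have 3: "jp_node t W (1 + t, e - of_int a, 1)"
  proof (rule jp_nodeI[where b = 0 and c = 1 and u = "- t" and w' = "(of_int a - 1 + t, 1, e - 1)"])
    have "e - of_int a = - t * (of_int a - 1 + t)"
      by (simp add: e_def algebra_simps power2_eq_square)
    moreover have "1 + t = - t * (e - 1)"
      using eqs(2) by Groebner_Basis.algebra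
    ultimately show "(e - of_int a - of_int 0 * (1 + t), 1 - of_int 1 * (1 + t), 1 + t) =
        scale3 (- t) (of_int a - 1 + t, 1, e - 1)"
      by (simp add: scale3_def)
    show "sig_indecomposable t (1 - of_int j * (1 + t))" if "0 \<le> j" "j < 1" for j
      using one that by (cases "j = 0") auto
  qed (use bounds units in \<open>auto simp: W_def\<close>)
  have 4: "jp_node t W (of_int a - 1 + t, 1, e - 1)"
  proof (rule jp_nodeI[where b = 0 and c = 1 and u = 1 and w' = "(1, e - of_int a - t, of_int a - 1 + t)"])
    show "sig_indecomposable t (e - 1 - of_int j * (of_int a - 1 + t))" if "0 \<le> j" "j < 1" for j
      using e_minus[of 1] a_ge that by (cases "j = 0") auto
  qed (use bounds in \<open>auto simp: W_def scale3_def\<close>)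
  have 5: "jp_node t W (1, e - of_int a - t, of_int a - 1 + t)"
  proof (rule jp_nodeI[where b = 0 and c = "a - 2" and u = \<kappa> and w' = "(1, 1 - t\<^sup>2, 1 - t)"])
    \<comment> \<open>The new first entry is \<open>e - a - t\<close>, that is,
      \<open>\<kappa>\<close>.\<close>
    have "1 + t = \<kappa> * (1 - t\<^sup>2)" "1 = \<kappa> * (1 - t)"
      using eqs(3) by Groebner_Basis.algebra+
    then show "(e - of_int a - t - of_int 0 * 1, of_int a - 1 + t - of_int (a - 2) * 1, 1) =
        scale3 \<kappa> (1, 1 - t\<^sup>2, 1 - t)"
      using eqs(4) by (simp add: scale3_def)
    show "sig_indecomposable t (of_int a - 1 + t - of_int j * 1)" if "0 \<le> j" "j < a - 2" for j
      using root_plus[of j] that by simp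
  qed (use bounds units in \<open>auto simp: W_def\<close>)
  have 6: "jp_node t W (1, 1 - t\<^sup>2, 1 - t)"
  proof (rule jp_nodeI[where b = 0 and c = 1 and u = 1 and w' = "(1 - t\<^sup>2, - t, 1)"])
    show "sig_indecomposable t (1 - t - of_int j * 1)" if "0 \<le> j" "j < 1" for j
      using unit[OF units(2)] that by (cases "j = 0") auto
  qed (use bounds in \<open>auto simp: W_def scale3_def\<close>)
  have 7: "jp_node t W (1 - t\<^sup>2, - t, 1)"
  proof (rule jp_nodeI[where b = 0 and c = 1 and u = 1 and w' = "(- t, t\<^sup>2, 1 - t\<^sup>2)"])
    show "sig_indecomposable t (1 - of_int j * (1 - t\<^sup>2))" if "0 \<le> j" "j < 1" for j
      using one that by (cases "j = 0") auto
  qed (use bounds in \<open>auto simp: W_def scale3_def\<close>)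
  have 8: "jp_node t W (- t, t\<^sup>2, 1 - t\<^sup>2)"
  proof (rule jp_nodeI[where b = 0 and c = a and u = "t\<^sup>2" and w' = "(1, of_int a - 2 + t, e)"])
    have "t\<^sup>2 * (of_int a - 2 + t) = 1 - t\<^sup>2 + of_int a * t" "t\<^sup>2 * e = - t"
      using eqs(1,2) by Groebner_Basis.algebra+
    then show "(t\<^sup>2 - of_int 0 * - t, 1 - t\<^sup>2 - of_int a * - t, - t) = scale3 (t\<^sup>2) (1, of_int a - 2 + t, e)"
      by (simp add: scale3_def)
    show "sig_indecomposable t (1 - t\<^sup>2 - of_int j * - t)" if "0 \<le> j" "j < a" for j
      using square[OF that] by simp
    show "1 - t\<^sup>2 < (of_int a + 1) * - t" using a_t(2) zero_le_power2[of t] by linarith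
  qed (use bounds units in \<open>auto simp: W_def algebra_simps power2_eq_square\<close>)
  \<comment> \<open>The middle entry and its partial quotient are both one less than at
    \<open>(1, of_int a - 1 + t, e)\<close>, so the remainders agree and the cycle closes.\<close>
  have 9: "jp_node t W (1, of_int a - 2 + t, e)"
  proof (rule jp_nodeI[where b = "a - 3" and c = a and u = 1 and w' = "(1 + t, e - of_int a, 1)"])
    show "sig_indecomposable t (of_int a - 2 + t - of_int j * 1)" if "0 \<le> j" "j < a - 3" for j
      using root_plus[of "j + 1"] that by (simp add: algebra_simps)
    show "sig_indecomposable t (e - of_int j * 1)" if "0 \<le> j" "j < a" for j
      using e_minus[of j] that by simp
  qed (use bounds in \<open>auto simp: W_def scale3_def\<close>)
  have 10: "jp_node t W (1, \<kappa>, \<kappa>\<^sup>2)"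
  proof (rule jp_nodeI[where b = 0 and c = 0 and u = "\<kappa>\<^sup>2" and w' = "(1 - t, 1, (1 - t)\<^sup>2)"])
    have "\<kappa> = \<kappa>\<^sup>2 * (1 - t)" "1 = \<kappa>\<^sup>2 * (1 - t)\<^sup>2"
      using eqs(3) by Groebner_Basis.algebra+
    then show "(\<kappa> - of_int 0 * 1, \<kappa>\<^sup>2 - of_int 0 * 1, 1) = scale3 (\<kappa>\<^sup>2) (1 - t, 1, (1 - t)\<^sup>2)"
      by (simp add: scale3_def)
    show "\<kappa>\<^sup>2 < (of_int 0 + 1) * 1" using \<kappa> by (simp add: power_less_one_iff)
  qed (use bounds units in \<open>auto simp: W_def\<close>)
  have 11: "jp_node t W (1 - t, 1, (1 - t)\<^sup>2)"
  proof (rule jp_nodeI[where b = 0 and c = 1 and u = 1 and w' = "(1, t\<^sup>2 - t, 1 - t)"])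
    show "sig_indecomposable t ((1 - t)\<^sup>2 - of_int j * (1 - t))" if "0 \<le> j" "j < 1" for j
      using unit[OF is_unit_power[OF units(2)]] that by (cases "j = 0") auto
  qed (use bounds in \<open>auto simp: W_def scale3_def power2_diff\<close>)
  have 12: "jp_node t W (1, t\<^sup>2 - t, 1 - t)"
  proof (rule jp_nodeI[where b = 0 and c = 1 and u = 1 and w' = "(t\<^sup>2 - t, - t, 1)"])
    show "sig_indecomposable t (1 - t - of_int j * 1)" if "0 \<le> j" "j < 1" for j
      using unit[OF units(2)] that by (cases "j = 0") auto
  qed (use bounds in \<open>auto simp: W_def scale3_def\<close>)
  have 13: "jp_node t W (t\<^sup>2 - t, - t, 1)"
  proof (rule jp_nodeI[where b = 0 and c = "a - 1" and u = "- t" and w' = "(1, 1 - t\<^sup>2, 1 - t)"])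
    have "1 - (of_int a - 1) * (t\<^sup>2 - t) = - t * (1 - t\<^sup>2)"
      using eqs(1) by Groebner_Basis.algebra
    moreover have "t\<^sup>2 - t = - t * (1 - t)"
      by (simp add: algebra_simps power2_eq_square)
    ultimately show "(- t - of_int 0 * (t\<^sup>2 - t), 1 - of_int (a - 1) * (t\<^sup>2 - t), t\<^sup>2 - t) =
        scale3 (- t) (1, 1 - t\<^sup>2, 1 - t)"
      by (simp add: scale3_def)
    \<comment> \<open>These elements form the diagonal \<open>p = q = j\<close> of the triangle,
      preceded by 1.\<close>
    show "sig_indecomposable t (1 - of_int j * (t\<^sup>2 - t))" if j: "0 \<le> j" "j < a - 1" for j
    proof (cases "j = 0")
      case False
      then show ?thesis
        by (intro triangle[of 1 _ j j]) (use j in \<open>auto simp: algebra_simps\<close>)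
    qed (use one in simp)
  qed (use bounds units in \<open>auto simp: W_def mult.commute\<close>)
  have nodes: "jp_node t W w" if "w \<in> W" for w
    using that 0 1 2 3 4 5 6 7 8 9 10 11 12 13 by (subst (asm) W_def) auto
  have "(1, - t, t\<^sup>2) \<in> W" "(1, \<kappa>, \<kappa>\<^sup>2) \<in> W" by (simp_all add: W_def)
  then show ?thesis
    using \<alpha> sig_indecomposable_nodes[OF nodes] by blast
qed

text \<open>For \<open>t = 1 + 1 / \<psi>''\<close> one has \<open>\<kappa> = - \<psi>''\<close>, so
  this is the expansion belonging to \<open>\<psi>''\<close>.\<close>

lemma r3_expansion:
  fixes t e \<kappa> :: real
  assumes t: "t = r3"
    and e_def: "e = of_int a - (of_int a - 1) * t - t\<^sup>2"
    and \<kappa>_def: "\<kappa> = - t * (t + of_int a)"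
    and \<alpha>: "\<alpha> \<in> jp_semiconvergents (1, \<kappa>, \<kappa>\<^sup>2)"
  shows "sig_indecomposable t \<alpha>"
proof -
  have root: "is_root a t" using root3 t by simp
  note eqs = root_eq[OF root e_def \<kappa>_def] e_eq[OF root e_def \<kappa>_def] \<kappa>_eq[OF root e_def \<kappa>_def]
    e_\<kappa>[OF root e_def \<kappa>_def]
  note units = units[OF root e_def \<kappa>_def]
  note unit = sig_indecomposable_unit[OF root] and one = sig_indecomposable_one[OF root]
  note linear = indec_linear[OF root e_def \<kappa>_def]
  note root_minus = indec_one_minus_root_minus[OF root e_def \<kappa>_def]
  note root_minus_e = indec_one_minus_root_minus_e[OF root e_def \<kappa>_def]
  have A: "real_of_int a \<ge> 3" using a_ge by simp
  have d: "t + of_int a > 0" "t + of_int a < 3 / 25" using r3_bounds t by auto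
  have \<kappa>: "\<kappa> > 0" "\<kappa> < 26 / 100"
  proof -
    \<comment> \<open>This is \<open>1 + 3 - 3 / 25\<close>. The resulting
      \<open>\<kappa> < 26 / 100\<close> just ensures \<open>4 * (t + a) + 2 * \<kappa> < 1\<close>,
      needed for the partial quotient 1 of the last entry of the fourth vector.\<close>
    have t_less: "1 - t > 388 / 100" using A d by linarith
    have "\<kappa> = 1 / (1 - t)"
      using inverse_unique[OF eqs(3)] by (simp only: inverse_eq_divide)
    moreover have "1 / (1 - t) > 0" using t_less by simp
    moreover have "1 / (1 - t) < 1 / (388 / 100)" using t_less by (intro divide_strict_left_mono) auto
    ultimately show "\<kappa> > 0" "\<kappa> < 26 / 100" by simp_all
  qed
  note bounds = A d \<kappa> eqs(4)
  \<comment> \<open>The terms of the expansion divided by units; the sixth vector leads back to the fourth.\<close>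
  define W :: "(real \<times> real \<times> real) set" where
    "W = {(1, \<kappa>, \<kappa>\<^sup>2), (1 - t, 1, (1 - t)\<^sup>2), (1, 1 - t - e, 1 - t), (1 - t - e - of_int a, 1 - t - of_int a, 1),
      (1, 1 + \<kappa>, of_int a - 1 - e), (1, - e - t, 1 - t)}"
  have 0: "jp_node t W (1, \<kappa>, \<kappa>\<^sup>2)"
  proof (rule jp_nodeI[where b = 0 and c = 0 and u = "\<kappa>\<^sup>2" and w' = "(1 - t, 1, (1 - t)\<^sup>2)"])
    have "\<kappa> = \<kappa>\<^sup>2 * (1 - t)" "1 = \<kappa>\<^sup>2 * (1 - t)\<^sup>2"
      using eqs(3) by Groebner_Basis.algebra+
    then show "(\<kappa> - of_int 0 * 1, \<kappa>\<^sup>2 - of_int 0 * 1, 1) = scale3 (\<kappa>\<^sup>2) (1 - t, 1, (1 - t)\<^sup>2)"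
      by (simp add: scale3_def)
    show "\<kappa>\<^sup>2 < (of_int 0 + 1) * 1" using \<kappa> by (simp add: power_less_one_iff)
  qed (use bounds units in \<open>auto simp: W_def\<close>)
  have 1: "jp_node t W (1 - t, 1, (1 - t)\<^sup>2)"
  proof (rule jp_nodeI[where b = 0 and c = a and u = 1 and w' = "(1, 1 - t - e, 1 - t)"])
    have "(1 - t)\<^sup>2 - of_int a * (1 - t) = 1 - t - e"
      unfolding e_def by (simp add: algebra_simps power2_eq_square)
    then show "(1 - of_int 0 * (1 - t), (1 - t)\<^sup>2 - of_int a * (1 - t), 1 - t) = scale3 1 (1, 1 - t - e, 1 - t)"
      by (simp add: scale3_def)
    show "sig_indecomposable t ((1 - t)\<^sup>2 - of_int j * (1 - t))" if "0 \<le> j" "j < a" for j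
      using sig_indecomposable_unit_mult[OF units(2) root_minus[of j]] that
      by (simp add: power2_eq_square algebra_simps)
    show "of_int a * (1 - t) \<le> (1 - t)\<^sup>2" "(1 - t)\<^sup>2 < (of_int a + 1) * (1 - t)"
      unfolding power2_eq_square using bounds by (auto intro!: mult_right_mono mult_strict_right_mono)
  qed (use bounds in \<open>auto simp: W_def\<close>)
  have 2: "jp_node t W (1, 1 - t - e, 1 - t)"
  proof (rule jp_nodeI[where b = a and c = a and u = 1 and
        w' = "(1 - t - e - of_int a, 1 - t - of_int a, 1)"])
    show "sig_indecomposable t (1 - t - e - of_int j * 1)" if "0 \<le> j" "j < a" for j
      using root_minus_e[OF that] by simp
    show "sig_indecomposable t (1 - t - of_int j * 1)" if "0 \<le> j" "j < a" for j
      using root_minus[of j] that by simp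
  qed (use bounds in \<open>auto simp: W_def scale3_def\<close>)
  have 3: "jp_node t W (1 - t - e - of_int a, 1 - t - of_int a, 1)"
  proof (rule jp_nodeI[where b = 1 and c = 1 and u = e and w' = "(1, 1 + \<kappa>, of_int a - 1 - e)"])
    have "t + e + of_int a = e * (1 + \<kappa>)"
      using eqs(1) unfolding e_def \<kappa>_def by Groebner_Basis.algebra
    moreover have "1 - t - e - of_int a = e * (of_int a - 1 - e)"
      using eqs(1) unfolding e_def by Groebner_Basis.algebra
    ultimately show "(1 - t - of_int a - of_int 1 * (1 - t - e - of_int a), 1 - of_int 1 * (1 - t - e - of_int a),
        1 - t - e - of_int a) = scale3 e (1, 1 + \<kappa>, of_int a - 1 - e)"
      by (simp add: scale3_def)
    show "sig_indecomposable t (1 - t - of_int a - of_int j * (1 - t - e - of_int a))" if "0 \<le> j" "j < 1" for j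
      using root_minus[of a] a_ge that by (cases "j = 0") auto
    show "sig_indecomposable t (1 - of_int j * (1 - t - e - of_int a))" if "0 \<le> j" "j < 1" for j
      using one that by (cases "j = 0") auto
  qed (use bounds units in \<open>auto simp: W_def\<close>)
  have 4: "jp_node t W (1, 1 + \<kappa>, of_int a - 1 - e)"
  proof (rule jp_nodeI[where b = 1 and c = "a - 2" and u = \<kappa> and w' = "(1, - e - t, 1 - t)"])
    have "1 - e = \<kappa> * (- e - t)" "1 = \<kappa> * (1 - t)"
      using eqs(2,3) by Groebner_Basis.algebra+
    then show "(1 + \<kappa> - of_int 1 * 1, of_int a - 1 - e - of_int (a - 2) * 1, 1) = scale3 \<kappa> (1, - e - t, 1 - t)"
      by (simp add: scale3_def)
    \<comment> \<open>Since \<open>1 / \<kappa> = 1 - t\<close>, this semiconvergent is where the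
      element \<open>2 - t\<close> enters.\<close>
    have "1 + \<kappa> = \<kappa> * (2 - t)" using eqs(3) by Groebner_Basis.algebra
    then show "sig_indecomposable t (1 + \<kappa> - of_int j * 1)" if "0 \<le> j" "j < 1" for j
      using sig_indecomposable_unit_mult[OF units(4) sig_indecomposable_two_minus[OF root]] that
      by (cases "j = 0") auto
    show "sig_indecomposable t (of_int a - 1 - e - of_int j * 1)" if j: "0 \<le> j" "j < a - 2" for j
    proof (rule linear[of "a - 1 - j" "- e"])
      show "of_int a - 1 - e - of_int j * 1 = - e * (1 + of_int (a - 1 - j) * t)"
        unfolding of_int_diff of_int_1 using eqs(2) by Groebner_Basis.algebra
    qed (use j units in auto)
  qed (use bounds units in \<open>auto simp: W_def\<close>)
  \<comment> \<open>The middle entry is that of the third vector less 1, with partial quotient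
    \<open>a - 1\<close> in place of \<open>a\<close>; the remainders agree and the cycle
    closes.\<close>
  have 5: "jp_node t W (1, - e - t, 1 - t)"
  proof (rule jp_nodeI[where b = "a - 1" and c = a and u = 1 and
        w' = "(1 - t - e - of_int a, 1 - t - of_int a, 1)"])
    show "sig_indecomposable t (- e - t - of_int j * 1)" if "0 \<le> j" "j < a - 1" for j
      using root_minus_e[of "j + 1"] that by (simp add: algebra_simps)
    show "sig_indecomposable t (1 - t - of_int j * 1)" if "0 \<le> j" "j < a" for j
      using root_minus[of j] that by simp
  qed (use bounds in \<open>auto simp: W_def scale3_def\<close>)
  have nodes: "jp_node t W w" if "w \<in> W" for w
    using that 0 1 2 3 4 5 by (subst (asm) W_def) auto
  have "(1, \<kappa>, \<kappa>\<^sup>2) \<in> W" by (simp add: W_def)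
  then show ?thesis
    using \<alpha> sig_indecomposable_nodes[OF nodes] by blast
qed

end

section \<open>Decomposable semiconvergents\<close>

lemma sig_decomposable_change_generator:
  assumes "\<phi> \<in> Z_adjoin \<theta>" "\<theta> \<in> Z_adjoin \<phi>"
  shows "sig_decomposable \<phi> = sig_decomposable \<theta>"
  by (simp add: fun_eq_iff sig_decomposable_def Z_adjoin_eqI[OF assms]
      sig_indecomposable_change_generator[OF assms])

lemma initial_semiconvergent:
  assumes "0 \<le> j" "of_int j + 1 \<le> z"
  shows "z - of_int j \<in> jp_semiconvergents (1, y, z)"
proof -
  have "j \<le> \<lfloor>z\<rfloor> - 1" using assms(2) by linarith
  then have "z - of_int j \<in> vector_semiconvergents (jp_seq (1, y, z) 0)"
    using assms by (auto simp: jp_seq_def vector_semiconvergents_def intro!: exI[of _ j])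
  then show ?thesis unfolding jp_semiconvergents_altdef by blast
qed

context cubic_roots
begin

text \<open>The witness has index \<open>a\<close> in the last entry of the second term, where the
  partial quotient is at least \<open>a + 1\<close>. It splits into two totally positive elements,
  one of them \<open>r1\<^sup>2 - r1\<close>.\<close>

lemma r1_decomposable: "\<exists>\<alpha>\<in>jp_semiconvergents (1, r1, r1\<^sup>2). sig_decomposable r1 \<alpha>"
proof (rule bexI)
  have A: "real_of_int a \<ge> 3" using a_ge by simp
  have "r1 * r1 < 5 / 4 * (5 / 4)" using r1_gt r1_bounds by (intro mult_strict_mono) auto
  then have "\<lfloor>r1\<rfloor> = 1" "\<lfloor>r1\<^sup>2\<rfloor> = 1"
    using r1_gt r1_bounds by (auto simp: floor_eq_iff power2_eq_square less_1_mult intro: less_imp_le)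
  then have "jp_seq (1, r1, r1\<^sup>2) 1 = (r1 - 1, r1\<^sup>2 - 1, 1)"
    by (simp add: jp_seq_def jp_step_def)
  moreover have "a \<le> \<lfloor>1 / (r1 - 1)\<rfloor> - 1"
  proof -
    have "of_int (a + 1) \<le> 1 / (r1 - 1)"
      using r1_gt r1_bounds by (simp add: pos_le_divide_eq mult.commute)
    then show ?thesis by linarith
  qed
  ultimately have "1 - of_int a * (r1 - 1) \<in> vector_semiconvergents (jp_seq (1, r1, r1\<^sup>2) 1)"
    using a_ge by (auto simp: vector_semiconvergents_def)
  then have "1 - of_int a * (r1 - 1) \<in> jp_semiconvergents (1, r1, r1\<^sup>2)"
    unfolding jp_semiconvergents_altdef by blast
  moreover have "1 - of_int a * (r1 - 1) = (of_int 0 + of_int (- 1) * r1 + of_int 1 * r1\<^sup>2) +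
      (of_int (a + 1) + of_int (1 - a) * r1 + of_int (- 1) * r1\<^sup>2)"
    by (simp add: algebra_simps)
  ultimately show "(of_int 0 + of_int (- 1) * r1 + of_int 1 * r1\<^sup>2) +
      (of_int (a + 1) + of_int (1 - a) * r1 + of_int (- 1) * r1\<^sup>2) \<in> jp_semiconvergents (1, r1, r1\<^sup>2)"
    by simp
  show "sig_decomposable r1 ((of_int 0 + of_int (- 1) * r1 + of_int 1 * r1\<^sup>2) +
      (of_int (a + 1) + of_int (1 - a) * r1 + of_int (- 1) * r1\<^sup>2))"
  proof (rule sig_decomposableI[OF root1 refl refl])
    fix t assume "is_root a t"
    then consider "t = r1" | "t = r2" | "t = r3" unfolding is_root_iff by blast
    then have "t\<^sup>2 - t > 0 \<and> of_int a + 1 - (of_int a - 1) * t - t\<^sup>2 > 0"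
    proof cases
      case 1
      \<comment> \<open>The cubic expanded around 1 makes positivity visible.\<close>
      have "of_int a + 1 - (of_int a - 1) * r1 - r1\<^sup>2 = (r1 - 1) ^ 3 + (of_int a + 1) * (r1 - 1)\<^sup>2"
        using root1 unfolding is_root_def by Groebner_Basis.algebra
      also have "\<dots> > 0" using r1_gt A by (intro add_pos_pos mult_pos_pos) auto
      finally show ?thesis using 1 r1_gt by (simp add: power2_eq_square)
    next
      case 2
      have "t * t < 1" using 2 r2_gt r2_neg by (metis abs_less_iff abs_square_less_1 less_trans minus_less_iff power2_eq_square zero_less_one)
      moreover have "(of_int a - 1) * t < 0" using 2 A r2_neg by (intro mult_pos_neg) auto
      ultimately show ?thesis using 2 A r2_neg zero_le_square[of t] by (simp add: power2_eq_square)
    next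
      case 3
      have "- t * (1 - (t + of_int a)) \<le> - t * 1"
        using 3 r3_less r3_bounds by (intro mult_left_mono) auto
      then have "of_int a + 1 - (of_int a - 1) * t - t\<^sup>2 > 0"
        using 3 r3_bounds by (simp add: algebra_simps power2_eq_square)
      moreover have "t\<^sup>2 - t > 0" using 3 r3_less zero_le_power2[of t] by linarith
      ultimately show ?thesis by simp
    qed
    then have "(t\<^sup>2 - t) * (of_int a + 1 - (of_int a - 1) * t - t\<^sup>2) > 0" by simp
    then show "(of_int 0 + of_int (- 1) * t + of_int 1 * t\<^sup>2) *
        (of_int (a + 1) + of_int (1 - a) * t + of_int (- 1) * t\<^sup>2) > 0"
      by (simp add: algebra_simps)
  qed
qed

text \<open>The witness is \<open>r3\<^sup>2 - 4\<close>, split into \<open>- 1 - r3\<close> and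
  \<open>r3\<^sup>2 + r3 - 3\<close>; both are negative at \<open>r1\<close> and \<open>r2\<close>
  and positive at \<open>r3\<close>.\<close>

lemma r3_decomposable: "\<exists>\<alpha>\<in>jp_semiconvergents (1, - r3, r3\<^sup>2). sig_decomposable r3 \<alpha>"
proof (rule bexI)
  have A: "real_of_int a \<ge> 3" using a_ge by simp
  have r3: "- r3 > 14 / 5" using r3_bounds A by simp
  have "(14 / 5) * (14 / 5) < - r3 * - r3" using r3 by (intro mult_strict_mono) auto
  then have "r3\<^sup>2 - of_int 4 \<in> jp_semiconvergents (1, - r3, r3\<^sup>2)"
    by (intro initial_semiconvergent) (auto simp: power2_eq_square)
  then show "(of_int (- 1) + of_int (- 1) * r3 + of_int 0 * r3\<^sup>2) + (of_int (- 3) + of_int 1 * r3 + of_int 1 * r3\<^sup>2)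
      \<in> jp_semiconvergents (1, - r3, r3\<^sup>2)"
    by simp
  show "sig_decomposable r3 ((of_int (- 1) + of_int (- 1) * r3 + of_int 0 * r3\<^sup>2) +
      (of_int (- 3) + of_int 1 * r3 + of_int 1 * r3\<^sup>2))"
  proof (rule sig_decomposableI[OF root3 refl refl])
    fix t assume "is_root a t"
    then consider "t = r1" | "t = r2" | "t = r3" unfolding is_root_iff by blast
    then have "(- 1 - t) * (t\<^sup>2 + t - 3) > 0"
    proof cases
      case 1
      have "t * t < 5 / 4 * (5 / 4)" using 1 r1_gt r1_bounds by (intro mult_strict_mono) auto
      then show ?thesis using 1 r1_gt r1_bounds by (intro mult_neg_neg) (auto simp: power2_eq_square)
    next
      case 2
      have "t * t < 1" using 2 r2_gt r2_neg by (metis abs_less_iff abs_square_less_1 less_trans minus_less_iff power2_eq_square zero_less_one)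
      then show ?thesis using 2 r2_gt r2_neg by (intro mult_neg_neg) (auto simp: power2_eq_square)
    next
      case 3
      have "(14 / 5) * (9 / 5) < - r3 * (- r3 - 1)" using r3 by (intro mult_strict_mono) auto
      then show ?thesis using 3 r3_less by (intro mult_pos_pos) (auto simp: power2_eq_square algebra_simps)
    qed
    then show "(of_int (- 1) + of_int (- 1) * t + of_int 0 * t\<^sup>2) * (of_int (- 3) + of_int 1 * t + of_int 1 * t\<^sup>2) > 0"
      by (simp add: algebra_simps)
  qed
qed

text \<open>The witness \<open>\<psi>\<^sup>2 - 2\<close> splits into \<open>\<psi>\<close> and
  \<open>(\<psi> - 2) * (\<psi> + 1)\<close>. At \<open>r1\<close> both are positive; at the other
  roots the conjugate of \<open>\<psi>\<close> lies between \<open>- 1\<close> and 0, and both are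
  negative.\<close>

lemma reciprocal_decomposable:
  assumes \<psi>: "\<psi> = r1 * (r1 + of_int a)"
  shows "\<exists>\<alpha>\<in>jp_semiconvergents (1, \<psi>, \<psi>\<^sup>2). sig_decomposable r1 \<alpha>"
proof (rule bexI)
  have A: "real_of_int a \<ge> 3" using a_ge by simp
  have "1 * 4 < r1 * (r1 + of_int a)" using r1_gt A by (intro mult_strict_mono) auto
  then have \<psi>_gt: "\<psi> > 4" by (simp add: \<psi>)
  have "4 * 4 < \<psi> * \<psi>" using \<psi>_gt by (intro mult_strict_mono) auto
  then have "\<psi>\<^sup>2 - of_int 2 \<in> jp_semiconvergents (1, \<psi>, \<psi>\<^sup>2)"
    by (intro initial_semiconvergent) (auto simp: power2_eq_square)
  have \<gamma>: "of_int (a - 1) + of_int (a\<^sup>2 + 1) * t + of_int a * t\<^sup>2 =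
      (t * (t + of_int a))\<^sup>2 - t * (t + of_int a) - 2" if "is_root a t" for t
    using that unfolding is_root_def of_int_diff of_int_add of_int_power of_int_1
    by Groebner_Basis.algebra
  have \<beta>: "of_int 0 + of_int a * t + of_int 1 * t\<^sup>2 = t * (t + of_int a)" for t :: real
    by (simp add: algebra_simps power2_eq_square)
  show "(of_int 0 + of_int a * r1 + of_int 1 * r1\<^sup>2) + (of_int (a - 1) + of_int (a\<^sup>2 + 1) * r1 + of_int a * r1\<^sup>2)
      \<in> jp_semiconvergents (1, \<psi>, \<psi>\<^sup>2)"
    unfolding \<gamma>[OF root1] \<beta> using \<open>\<psi>\<^sup>2 - of_int 2 \<in> _\<close> by (simp add: \<psi>[symmetric])
  show "sig_decomposable r1 ((of_int 0 + of_int a * r1 + of_int 1 * r1\<^sup>2) +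
      (of_int (a - 1) + of_int (a\<^sup>2 + 1) * r1 + of_int a * r1\<^sup>2))"
  proof (rule sig_decomposableI[OF root1 refl refl])
    fix t assume t: "is_root a t"
    have factor: "u * (u\<^sup>2 - u - 2) = u * ((u - 2) * (u + 1))" for u :: real
      by (simp add: algebra_simps power2_eq_square)
    define u where "u = t * (t + of_int a)"
    have "t = r1 \<or> t < 0" using t r2_neg r3_less unfolding is_root_iff by auto
    then have "u * ((u - 2) * (u + 1)) > 0"
    proof
      assume "t = r1"
      then have "u > 4" using \<psi>_gt by (simp add: u_def \<psi>)
      then show ?thesis by (intro mult_pos_pos) auto
    next
      assume "t < 0"
      have "(1 - t) * (- u) = 1" using root_identities(2)[OF t] by (simp add: u_def)
      then have "- u = 1 / (1 - t)" using inverse_unique by (metis inverse_eq_divide)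
      moreover have "1 / (1 - t) > 0" "1 / (1 - t) < 1" using \<open>t < 0\<close> by (simp_all add: field_simps)
      ultimately have "u < 0" "u > - 1" by linarith+
      then show ?thesis by (intro mult_neg_neg mult_neg_pos) auto
    qed
    then show "(of_int 0 + of_int a * t + of_int 1 * t\<^sup>2) *
        (of_int (a - 1) + of_int (a\<^sup>2 + 1) * t + of_int a * t\<^sup>2) > 0"
      unfolding \<beta> \<gamma>[OF t] u_def[symmetric] factor .
  qed
qed

end

section \<open>Passage from the second family to the first, and conclusion\<close>

text \<open>The constant coefficient \<open>- 1\<close> makes \<open>1 / x\<close> an integer
  polynomial in \<open>x\<close>, and \<open>x = 1 / (\<theta> - 1)\<close> is one in
  \<open>\<theta>\<close> because \<open>1 - \<theta>\<close> is a unit; so the two orders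
  coincide.\<close>

lemma reciprocal_root:
  fixes x :: real
  assumes x: "x ^ 3 - (of_int b - 1) * x\<^sup>2 - of_int b * x - 1 = 0" and \<theta>: "\<theta> = 1 + 1 / x"
  shows "is_root (b - 2) \<theta>" "x = \<theta> * (\<theta> + of_int (b - 2))"
    "sig_indecomposable x = sig_indecomposable \<theta>" "sig_decomposable x = sig_decomposable \<theta>"
proof -
  have "x \<noteq> 0" using x by auto
  have inv: "x * (x\<^sup>2 - (of_int b - 1) * x - of_int b) = 1"
    using x by Groebner_Basis.algebra
  have \<theta>x: "x * \<theta> = x + 1" using \<open>x \<noteq> 0\<close> by (simp add: \<theta> field_simps)
  have \<theta>_eq: "\<theta> = 1 + (x\<^sup>2 - (of_int b - 1) * x - of_int b)"
    using inv \<theta>x by Groebner_Basis.algebra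
  show "is_root (b - 2) \<theta>"
    unfolding is_root_def of_int_diff of_int_numeral using inv \<theta>_eq by Groebner_Basis.algebra
  show x_eq: "x = \<theta> * (\<theta> + of_int (b - 2))"
    unfolding of_int_diff of_int_numeral using inv \<theta>_eq by Groebner_Basis.algebra
  have gen: "x \<in> Z_adjoin \<theta>" "\<theta> \<in> Z_adjoin x"
    by (subst x_eq, blast) (subst \<theta>_eq, auto intro!: Z_adjoin_add Z_adjoin_diff Z_adjoin_mult Z_adjoin_power)
  show "sig_indecomposable x = sig_indecomposable \<theta>" "sig_decomposable x = sig_decomposable \<theta>"
    using gen by (rule sig_indecomposable_change_generator, rule sig_decomposable_change_generator)
qed

theorem theorem1p4:
  shows
    "(\<forall>(a::int) (\<rho>::real) (\<rho>'::real) (\<rho>''::real).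
        a \<ge> 3 \<longrightarrow>
        {x::real. x ^ 3 + (of_int a - 1) * x\<^sup>2 - of_int a * x - 1 = 0} = {\<rho>, \<rho>', \<rho>''} \<longrightarrow>
        \<rho> > 1 \<longrightarrow> -1 < \<rho>' \<longrightarrow> \<rho>' < 0 \<longrightarrow> \<rho>'' < -1 \<longrightarrow>
        (\<forall>\<alpha>\<in>jp_semiconvergents (1, -\<rho>', \<rho>'\<^sup>2). sig_indecomposable \<rho>' \<alpha>) \<and>
        (\<exists>\<alpha>\<in>jp_semiconvergents (1, \<rho>, \<rho>\<^sup>2). sig_decomposable \<rho> \<alpha>) \<and>
        (\<exists>\<alpha>\<in>jp_semiconvergents (1, -\<rho>'', \<rho>''\<^sup>2). sig_decomposable \<rho>'' \<alpha>)) \<and>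
     (\<forall>(a::int) (\<psi>::real) (\<psi>'::real) (\<psi>''::real).
        a \<ge> 5 \<longrightarrow>
        {x::real. x ^ 3 - (of_int a - 1) * x\<^sup>2 - of_int a * x - 1 = 0} = {\<psi>, \<psi>', \<psi>''} \<longrightarrow>
        \<psi> > 0 \<longrightarrow> -1 < \<psi>' \<longrightarrow> \<psi>' < -1/2 \<longrightarrow> -1/2 < \<psi>'' \<longrightarrow> \<psi>'' < 0 \<longrightarrow>
        (\<forall>\<alpha>\<in>jp_semiconvergents (1, -\<psi>', \<psi>'\<^sup>2). sig_indecomposable \<psi>' \<alpha>) \<and>
        (\<forall>\<alpha>\<in>jp_semiconvergents (1, -\<psi>'', \<psi>''\<^sup>2). sig_indecomposable \<psi>'' \<alpha>) \<and>
        (\<exists>\<alpha>\<in>jp_semiconvergents (1, \<psi>, \<psi>\<^sup>2). sig_decomposable \<psi> \<alpha>))"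
proof (intro conjI allI impI)
  fix a :: int and \<rho> \<rho>' \<rho>'' :: real
  assume *: "a \<ge> 3" "{x::real. x ^ 3 + (of_int a - 1) * x\<^sup>2 - of_int a * x - 1 = 0} = {\<rho>, \<rho>', \<rho>''}"
    "\<rho> > 1" "-1 < \<rho>'" "\<rho>' < 0" "\<rho>'' < -1"
  have root: "is_root a x" if "x \<in> {\<rho>, \<rho>', \<rho>''}" for x
    using that unfolding *(2)[symmetric] by (simp add: is_root_def)
  interpret cubic_roots a \<rho> \<rho>' \<rho>''
    using * root by unfold_locales auto
  show "\<forall>\<alpha>\<in>jp_semiconvergents (1, -\<rho>', \<rho>'\<^sup>2). sig_indecomposable \<rho>' \<alpha>"
    using r2_expansions[OF refl refl refl] by blast
  show "\<exists>\<alpha>\<in>jp_semiconvergents (1, \<rho>, \<rho>\<^sup>2). sig_decomposable \<rho> \<alpha>"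
    by (rule r1_decomposable)
  show "\<exists>\<alpha>\<in>jp_semiconvergents (1, -\<rho>'', \<rho>''\<^sup>2). sig_decomposable \<rho>'' \<alpha>"
    by (rule r3_decomposable)
next
  fix a :: int and \<psi> \<psi>' \<psi>'' :: real
  assume *: "a \<ge> 5" "{x::real. x ^ 3 - (of_int a - 1) * x\<^sup>2 - of_int a * x - 1 = 0} = {\<psi>, \<psi>', \<psi>''}"
    "\<psi> > 0" "-1 < \<psi>'" "\<psi>' < -1/2" "-1/2 < \<psi>''" "\<psi>'' < 0"
  have root: "x ^ 3 - (of_int a - 1) * x\<^sup>2 - of_int a * x - 1 = 0" if "x \<in> {\<psi>, \<psi>', \<psi>''}" for x
    using that unfolding *(2)[symmetric] by simp
  note 1 = reciprocal_root[OF root[OF insertI1] refl]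
    and 2 = reciprocal_root[OF root[OF insertI2[OF insertI1]] refl]
    and 3 = reciprocal_root[OF root[OF insertI2[OF insertI2[OF insertI1]]] refl]
  \<comment> \<open>The map \<open>x \<mapsto> 1 + 1 / x\<close> carries the intervals of
    \<open>\<psi>\<close>, \<open>\<psi>'\<close>, \<open>\<psi>''\<close> to those of
    \<open>r1\<close>, \<open>r2\<close>, \<open>r3\<close> in this order; \<open>a \<ge> 5\<close>
    becomes \<open>a - 2 \<ge> 3\<close>.\<close>
  interpret cubic_roots "a - 2" "1 + 1 / \<psi>" "1 + 1 / \<psi>'" "1 + 1 / \<psi>''"
  proof
    show "- 1 < 1 + 1 / \<psi>'" "1 + 1 / \<psi>' < 0" "1 + 1 / \<psi>'' < - 1"
      using * by (simp_all add: field_simps)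
  qed (use * 1 2 3 in auto)
  \<comment> \<open>So \<open>- \<psi>'\<close> is the \<open>\<kappa>\<close> belonging to
    \<open>1 + 1 / \<psi>'\<close>, and the vector has the form
    \<open>(1, \<kappa>, \<kappa>\<^sup>2)\<close>.\<close>
  have \<psi>': "- \<psi>' = - (1 + 1 / \<psi>') * (1 + 1 / \<psi>' + of_int (a - 2))"
    using arg_cong[OF 2(2), of uminus] by (simp only: mult_minus_left)
  show "\<forall>\<alpha>\<in>jp_semiconvergents (1, -\<psi>', \<psi>'\<^sup>2). sig_indecomposable \<psi>' \<alpha>"
    using r2_expansions[OF refl refl \<psi>'] unfolding 2(3) power2_minus by blast
  have \<psi>'': "- \<psi>'' = - (1 + 1 / \<psi>'') * (1 + 1 / \<psi>'' + of_int (a - 2))"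
    using arg_cong[OF 3(2), of uminus] by (simp only: mult_minus_left)
  show "\<forall>\<alpha>\<in>jp_semiconvergents (1, -\<psi>'', \<psi>''\<^sup>2). sig_indecomposable \<psi>'' \<alpha>"
    using r3_expansion[OF refl refl \<psi>''] unfolding 3(3) power2_minus by blast
  show "\<exists>\<alpha>\<in>jp_semiconvergents (1, \<psi>, \<psi>\<^sup>2). sig_decomposable \<psi> \<alpha>"
    using reciprocal_decomposable[OF 1(2)] 1(4) by simp
qed

end
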